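(* Let $G$ be a locally compact group. If $G$ has the invariant normalized integral property for one of the Banach spaces $$L^{\infty}(G),\quad \mathcal{C}^b(G),\quad \mathcal{C}^b_{lu}(G),\quad \mathcal{C}^b_{ru}(G),\quad \mathcal{C}^b_u(G),$$ then $G$ has the invariant normalized integral property for all the others.
   Context: Locally compact groups are Hausdorff; $G$ carries a fixed left Haar measure $m_G$. $L^\infty(G)$ is the space of bounded Borel measurable real functions on $G$ modulo null sets (essential supremum norm, almost-everywhere order). $\mathcal{C}^b(G)$ is the space of bounded continuous real functions on $G$ (supremum norm, pointwise order). $\mathcal{C}^b_{ru}(G)$ is the set of $f\in\mathcal{C}^b(G)$ for which $g\mapsto f(g^{-1}\,\cdot\,)$ is sup-norm continuous, $\mathcal{C}^b_{lu}(G)$ is the set of $f\in\mathcal{C}^b(G)$ for which $g\mapsto f(\,\cdot\,g)$ is sup-norm continuous, and $\mathcal{C}^b_u(G)=\mathcal{C}^b_{ru}(G)\cap\mathcal{C}^b_{lu}(G)$. On each of these spaces $G$ acts by left translation, $(gf)(x)=f(g^{-1}x)$. Let $E$ be one of these spaces. For a non-zero $f\in E$ with $f\ge 0$, let $(E,f)$ be the set of all $h\in E$ such that $|h|\le\sum_{j=1}^n g_jf$ for some $g_1,\dots,g_n\in G$; it is a $G$-invariant linear subspace. An invariant normalized integral on $(E,f)$ is a positive, $G$-invariant linear functional $\mathrm{I}$ on $(E,f)$ with $\mathrm{I}(f)=1$. $G$ has the invariant normalized integral property for $E$ if $(E,f)$ admits an invariant normalized integral for every non-zero $f\ge 0$ in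 $E$. *)

theory Defs
  imports "HOL-Analysis.Analysis"
begin

text \<open>
  Groups are written additively, because \<^class>\<open>topological_group_add\<close> is the library's class of
  topological groups. It does not assume commutativity: \<^term>\<open>x + y\<close> is the product \<open>xy\<close> and
  \<^term>\<open>- x\<close> is the inverse.
\<close>

text \<open>
  Left Haar measures are Borel measures that are finite on compact sets and inner regular with respect
  to compact sets on every Borel set. If the group is not \<open>\<sigma>\<close>-compact, the variant that is only
  outer regular on Borel sets may give infinite measure to sets that meet every compact set in a null
  set. With inner regularity those sets are null, so the null sets are the locally null sets, as
  is usual for \<open>L\<^sup>\<infinity>\<close> of a locally compact group.
\<close>

definition left_haar_measure :: "'a::{topological_group_add,t2_space} measure \<Rightarrow> bool" where
  "left_haar_measure m \<longleftrightarrow>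
     sets m = sets borel \<and>
     emeasure m UNIV \<noteq> 0 \<and>
     (\<forall>K. compact K \<longrightarrow> emeasure m K < \<infinity>) \<and>
     (\<forall>A\<in>sets borel. emeasure m A = (SUP K\<in>{K. K \<subseteq> A \<and> compact K}. emeasure m K)) \<and>
     (\<forall>g. \<forall>A\<in>sets borel. emeasure m ((+) g ` A) = emeasure m A)"

definition left_translate :: "'a::group_add \<Rightarrow> ('a \<Rightarrow> real) \<Rightarrow> ('a \<Rightarrow> real)" where
  "left_translate g f = (\<lambda>x. f (- g + x))"

definition right_translate :: "'a::group_add \<Rightarrow> ('a \<Rightarrow> real) \<Rightarrow> ('a \<Rightarrow> real)" where
  "right_translate g f = (\<lambda>x. f (x + g))"

text \<open>
  A function space is a set of real functions together with a filter. Equality and order of its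
  elements are understood to hold eventually along the filter: the filter \<^term>\<open>ae_filter m\<close> gives the
  almost-everywhere relations and \<^term>\<open>top\<close> the pointwise ones. Hence the elements of \<open>L\<^sup>\<infinity>(G)\<close> are
  represented by functions, and a map defined on the quotient is a map on representatives that respects
  almost-everywhere equality.
\<close>

type_synonym 'a function_space = "('a \<Rightarrow> real) set \<times> 'a filter"

definition L_infty :: "'a::topological_space measure \<Rightarrow> 'a function_space" where
  "L_infty m = ({f. f \<in> borel_measurable borel \<and> bounded (range f)}, ae_filter m)"

definition Cb :: "'a::topological_space function_space" where
  "Cb = (bcontfun, top)"

text \<open>
  The topology on \<^typ>\<open>'a \<Rightarrow>\<^sub>C real\<close> is that of the supremum norm. \<^const>\<open>Bcontfun\<close> is unspecified off
  \<^const>\<open>bcontfun\<close>, but translates of a function in \<^const>\<open>bcontfun\<close> are again in \<^const>\<open>bcontfun\<close>.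
\<close>

definition Cb_ru :: "'a::topological_group_add function_space" where
  "Cb_ru = ({f \<in> bcontfun. continuous_on UNIV (\<lambda>g. Bcontfun (left_translate g f))}, top)"

definition Cb_lu :: "'a::topological_group_add function_space" where
  "Cb_lu = ({f \<in> bcontfun. continuous_on UNIV (\<lambda>g. Bcontfun (right_translate g f))}, top)"

definition Cb_u :: "'a::topological_group_add function_space" where
  "Cb_u = (fst Cb_ru \<inter> fst Cb_lu, top)"

text \<open>The subspace \<open>(E,f)\<close>; the list \<open>gs\<close> is the tuple \<open>g\<^sub>1,\<dots>,g\<^sub>n\<close>.\<close>

definition dominated :: "'a::group_add function_space \<Rightarrow> ('a \<Rightarrow> real) \<Rightarrow> ('a \<Rightarrow> real) set" where
  "dominated E f =
     {h \<in> fst E. \<exists>gs. \<forall>\<^sub>F x in snd E. \<bar>h x\<bar> \<le> (\<Sum>g\<leftarrow>gs. left_translate g f x)}"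

definition invariant_normalized_integral ::
    "'a::group_add function_space \<Rightarrow> ('a \<Rightarrow> real) \<Rightarrow> (('a \<Rightarrow> real) \<Rightarrow> real) \<Rightarrow> bool" where
  "invariant_normalized_integral E f I \<longleftrightarrow>
     (\<forall>h\<in>dominated E f. \<forall>k\<in>dominated E f. (\<forall>\<^sub>F x in snd E. h x = k x) \<longrightarrow> I h = I k) \<and>
     (\<forall>h\<in>dominated E f. \<forall>k\<in>dominated E f. I (\<lambda>x. h x + k x) = I h + I k) \<and>
     (\<forall>c. \<forall>h\<in>dominated E f. I (\<lambda>x. c * h x) = c * I h) \<and>
     (\<forall>h\<in>dominated E f. (\<forall>\<^sub>F x in snd E. 0 \<le> h x) \<longrightarrow> 0 \<le> I h) \<and>
     (\<forall>g. \<forall>h\<in>dominated E f. I (left_translate g h) = I h) \<and>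
     I f = 1"

definition invariant_normalized_integral_property :: "'a::group_add function_space \<Rightarrow> bool" where
  "invariant_normalized_integral_property E \<longleftrightarrow>
     (\<forall>f\<in>fst E. (\<forall>\<^sub>F x in snd E. 0 \<le> f x) \<and> \<not> (\<forall>\<^sub>F x in snd E. f x = 0) \<longrightarrow>
        (\<exists>I. invariant_normalized_integral E f I))"

end

theory Submission
  imports Defs
begin

text \<open>
  The properties are linked in the cycle \<open>L\<^sup>\<infinity> \<rightarrow> C\<^sup>b \<rightarrow> C\<^sup>b\<^sub>r\<^sub>u \<rightarrow> C\<^sup>b\<^sub>u \<rightarrow> C\<^sup>b\<^sub>l\<^sub>u \<rightarrow> L\<^sup>\<infinity>\<close>. The first
  three implications are restrictions of integrals. For the last one, right convolution with a
  non-negative \<open>k \<in> C\<^sub>c(G)\<close> is positive, commutes with left translations and maps \<open>L\<^sup>\<infinity>\<close> into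
  \<open>C\<^sup>b\<^sub>l\<^sub>u\<close>, so that integrals pull back along it.

  For \<open>C\<^sup>b\<^sub>u \<rightarrow> C\<^sup>b\<^sub>l\<^sub>u\<close> one pulls back an integral \<open>J\<close> along \<open>h \<mapsto> \<phi> * h\<close> with \<open>\<phi> \<in> C\<^sub>c(G)\<close>. This map
  does not commute with left translations. But for fixed \<open>h\<close> the functional \<open>\<phi> \<mapsto> J (\<phi> * h)\<close> on
  \<open>C\<^sub>c(G)\<close> is left invariant, hence a multiple of the Haar integral. As \<open>\<phi> * (gh)\<close> is the convolution
  with \<open>h\<close> of a function with the same integral as \<open>\<phi>\<close>, the invariance of \<open>h \<mapsto> J (\<phi> * h)\<close> follows.

  Uniqueness of the Haar integral is proved without Fubini's theorem: \<open>f * \<phi>\<close> is uniformly close to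
  a multiple of \<open>f\<close> if \<open>\<phi>\<close> is supported near the identity, and also to linear combinations of
  left translates of \<open>\<phi>\<close>, with all supports in a fixed compact set.
\<close>

section \<open>Compactly supported continuous functions\<close>

definition Cc :: "('a::topological_space \<Rightarrow> real) set" where
  "Cc = {f. continuous_on UNIV f \<and> (\<exists>K. compact K \<and> (\<forall>x. x \<notin> K \<longrightarrow> f x = 0))}"

lemma CcI: "continuous_on UNIV f \<Longrightarrow> compact K \<Longrightarrow> (\<And>x. x \<notin> K \<Longrightarrow> f x = 0) \<Longrightarrow> f \<in> Cc"
  unfolding Cc_def by blast

lemma CcE:
  assumes "f \<in> Cc"
  obtains K where "compact K" "\<And>x. x \<notin> K \<Longrightarrow> f x = 0"
  using assms unfolding Cc_def by blast

lemma Cc_continuous: "f \<in> Cc \<Longrightarrow> continuous_on UNIV f"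
  unfolding Cc_def by blast

lemma continuous_on_UNIV_o:
  assumes "continuous_on UNIV f" "continuous_on A g"
  shows "continuous_on A (\<lambda>x. f (g x))"
  using continuous_on_compose2[OF assms(1) assms(2)] by simp

lemma Cc_borel: "f \<in> Cc \<Longrightarrow> f \<in> borel_measurable borel"
  by (intro borel_measurable_continuous_onI Cc_continuous)

lemma Cc_bound:
  assumes "f \<in> Cc"
  obtains B where "B > 0" "\<And>x. \<bar>f x\<bar> \<le> B"
proof -
  obtain K where K: "compact K" "\<And>x. x \<notin> K \<Longrightarrow> f x = 0"
    using CcE[OF assms] by blast
  have "bounded (f ` K)"
    using K(1) Cc_continuous[OF assms]
    by (intro compact_imp_bounded compact_continuous_image) (auto intro: continuous_on_subset)
  then obtain B where B: "B > 0" "\<And>x. x \<in> K \<Longrightarrow> \<bar>f x\<bar> \<le> B"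
    unfolding bounded_pos by auto
  have "\<bar>f x\<bar> \<le> B" for x using B K(2)[of x] by (cases "x \<in> K") auto
  with B(1) show ?thesis using that by blast
qed

lemma Cc_mult_left:
  assumes "f \<in> Cc" "continuous_on UNIV g"
  shows "(\<lambda>x. f x * g x) \<in> Cc"
proof -
  obtain K where K: "compact K" "\<And>x. x \<notin> K \<Longrightarrow> f x = 0"
    using CcE[OF assms(1)] by blast
  show ?thesis
    by (rule CcI[OF _ K(1)]) (use K assms Cc_continuous in \<open>auto intro!: continuous_intros\<close>)
qed

lemma Cc_cmult: "f \<in> Cc \<Longrightarrow> (\<lambda>x. c * f x) \<in> Cc"
  using Cc_mult_left[of f "\<lambda>_. c"] by (simp add: mult.commute)

lemma Cc_abs:
  assumes "f \<in> Cc" shows "(\<lambda>x. \<bar>f x\<bar>) \<in> Cc"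
proof -
  obtain K where K: "compact K" "\<And>x. x \<notin> K \<Longrightarrow> f x = 0"
    using CcE[OF assms(1)] by blast
  show ?thesis
    by (rule CcI[OF _ K(1)]) (use K assms Cc_continuous in \<open>auto intro!: continuous_intros\<close>)
qed

lemma Cc_add:
  assumes "f \<in> Cc" "g \<in> Cc"
  shows "(\<lambda>x. f x + g x) \<in> Cc"
proof -
  obtain K where K: "compact K" "\<And>x. x \<notin> K \<Longrightarrow> f x = 0"
    using CcE[OF assms(1)] by blast
  obtain L where L: "compact L" "\<And>x. x \<notin> L \<Longrightarrow> g x = 0"
    using CcE[OF assms(2)] by blast
  show ?thesis
    by (rule CcI[OF _ compact_Un[OF K(1) L(1)]])
      (use K L assms Cc_continuous in \<open>auto intro!: continuous_intros\<close>)
qed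

lemma Cc_zero: "(\<lambda>x. 0) \<in> Cc"
  by (rule CcI[of _ "{}"]) auto

lemma Cc_sum:
  "finite P \<Longrightarrow> (\<And>p. p \<in> P \<Longrightarrow> F p \<in> Cc) \<Longrightarrow> (\<lambda>x. \<Sum>p\<in>P. F p x) \<in> Cc"
  by (induction P rule: finite_induct) (auto intro!: Cc_zero Cc_add)

text \<open>If \<open>p x\<close> lies in \<open>K\<close>, then \<open>x = q (p x)\<close> lies in
  the image of \<open>K\<close> under \<open>q\<close>, which is compact. So \<open>q\<close>
  carries the support back.\<close>

lemma Cc_comp:
  fixes f :: "'a::t2_space \<Rightarrow> real"
  assumes "f \<in> Cc" "continuous_on UNIV p" "continuous_on UNIV q" "\<And>x. q (p x) = x"
  shows "(\<lambda>x. f (p x)) \<in> Cc"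
proof -
  obtain K where K: "compact K" "\<And>x. x \<notin> K \<Longrightarrow> f x = 0"
    using CcE[OF assms(1)] by blast
  show ?thesis
  proof (rule CcI)
    show "continuous_on UNIV (\<lambda>x. f (p x))"
      using assms(2) Cc_continuous[OF assms(1)] continuous_on_UNIV_o by blast
    show "compact (q ` K)"
      using K(1) assms(3) compact_continuous_image continuous_on_subset by blast
    show "f (p x) = 0" if "x \<notin> q ` K" for x
      using that assms(4) K(2) by (metis imageI)
  qed
qed

lemma continuous_on_translations:
  fixes g :: "'a::topological_group_add"
  shows "continuous_on A (\<lambda>x. g + x)" "continuous_on A (\<lambda>x. x + g)"
    "continuous_on A (\<lambda>x::'a. - x)" "continuous_on A (\<lambda>x. - x + g)"
  by (auto intro!: continuous_intros continuous_on_minus simp: continuous_on_def tendsto_intros)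

lemma Cc_translate:
  fixes f :: "'a::{topological_group_add,t2_space} \<Rightarrow> real"
  assumes "f \<in> Cc"
  shows "(\<lambda>x. f (g + x)) \<in> Cc" "(\<lambda>x. f (x + g)) \<in> Cc" "(\<lambda>x. f (- x)) \<in> Cc"
proof -
  show "(\<lambda>x. f (g + x)) \<in> Cc"
    by (rule Cc_comp[OF assms continuous_on_translations(1) continuous_on_translations(1)[of _ "-g"]])
      (simp add: add.assoc[symmetric])
  show "(\<lambda>x. f (x + g)) \<in> Cc"
    by (rule Cc_comp[OF assms continuous_on_translations(2) continuous_on_translations(2)[of _ "-g"]])
      (simp add: add.assoc)
  show "(\<lambda>x. f (- x)) \<in> Cc"
    by (rule Cc_comp[OF assms continuous_on_translations(3) continuous_on_translations(3)]) simp
qed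

lemma Cc_left_translate:
  fixes f :: "'a::{topological_group_add,t2_space} \<Rightarrow> real"
  shows "f \<in> Cc \<Longrightarrow> left_translate g f \<in> Cc"
  unfolding left_translate_def by (rule Cc_translate)

section \<open>Compact sets, translates and finite covers\<close>

lemma compact_add:
  fixes S T :: "'a::topological_group_add set"
  assumes "compact S" "compact T"
  shows "compact ((\<lambda>(x, y). x + y) ` (S \<times> T))"
  by (intro compact_continuous_image compact_Times assms)
    (auto simp: case_prod_unfold intro!: continuous_intros)

lemma open_translate:
  fixes U :: "'a::topological_group_add set"
  assumes "open U"
  shows "open ((+) g ` U)"
proof -
  have "(+) g ` U = (\<lambda>x. - g + x) -` U"
    by (auto simp: image_iff add.assoc[symmetric]) (metis add.assoc add.right_neutral add_0 right_minus)
  then show ?thesis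
    using continuous_on_translations(1)[of UNIV "-g"] assms by (simp add: open_vimage)
qed

text \<open>The translates of \<open>U\<close> by points of \<open>K\<close> are open and cover
  \<open>K\<close>. Keeping the centres in \<open>K\<close> lets \<open>l_conv\<close> confine its
  Riemann sums to one compact set.\<close>

lemma compact_cover_translates:
  fixes K U :: "'a::topological_group_add set"
  assumes "compact K" "open U" "0 \<in> U"
  obtains P where "finite P" "P \<subseteq> K" "K \<subseteq> (\<Union>p\<in>P. (+) p ` U)"
proof -
  have "K \<subseteq> (\<Union>p\<in>K. (+) p ` U)"
    using assms(3) by (force simp: image_iff)
  then show ?thesis
    using compactE_image[OF assms(1), of K "\<lambda>p. (+) p ` U"] open_translate[OF assms(2)] that by metis
qed

text \<open>On the neighbourhood \<open>?U\<close> of the identity, \<phi> exceeds half of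
  \<open>\<phi> 0\<close>. Finitely many translates of \<open>?U\<close> cover a compact set off
  which \<psi> vanishes, and there the sum of the translates of \<phi> is bounded below.\<close>

lemma translate_domination:
  fixes \<phi> \<psi> :: "'a::{topological_group_add,t2_space} \<Rightarrow> real"
  assumes "\<phi> \<in> Cc" "\<And>x. 0 \<le> \<phi> x" "0 < \<phi> 0" "\<psi> \<in> Cc"
  obtains gs where "\<And>x. \<bar>\<psi> x\<bar> \<le> (\<Sum>g\<leftarrow>gs. left_translate g \<phi> x)"
proof -
  let ?U = "{x. \<phi> 0 / 2 < \<phi> x}"
  have U: "open ?U" "0 \<in> ?U"
    using Cc_continuous[OF assms(1)] assms(3)
    by (auto intro!: open_Collect_less continuous_intros)
  obtain K where K: "compact K" "\<And>x. x \<notin> K \<Longrightarrow> \<psi> x = 0"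
    using CcE[OF assms(4)] by blast
  obtain P where P: "finite P" "K \<subseteq> (\<Union>p\<in>P. (+) p ` ?U)"
    using compact_cover_translates[OF K(1) U] by metis
  obtain ps where ps: "set ps = P" using P(1) finite_list by blast
  obtain B where B: "B > 0" "\<And>x. \<bar>\<psi> x\<bar> \<le> B" using Cc_bound[OF assms(4)] by blast
  obtain n where n: "B < real n * (\<phi> 0 / 2)"
    using reals_Archimedean3[of "\<phi> 0 / 2"] assms(3) by auto
  define S where "S x = (\<Sum>g\<leftarrow>ps. left_translate g \<phi> x)" for x
  \<comment> \<open>The tuples in \<open>dominated\<close> carry no coefficients, so the factor
    \<open>n\<close> is obtained by repeating the list \<open>ps\<close>.\<close>
  have sum_rep: "(\<Sum>g\<leftarrow>concat (replicate n ps). left_translate g \<phi> x) = real n * S x" for x n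
    by (induction n) (auto simp: S_def algebra_simps)
  have nonneg: "0 \<le> S x" for x
    unfolding S_def using assms(2) by (auto intro!: sum_list_nonneg simp: left_translate_def)
  have "\<bar>\<psi> x\<bar> \<le> real n * S x" for x
  proof (cases "x \<in> K")
    case True
    then obtain p u where pu: "p \<in> P" "u \<in> ?U" "x = p + u" using P(2) by auto
    have "- p + x = u" using pu by (simp add: add.assoc[symmetric])
    then have "\<phi> 0 / 2 \<le> left_translate p \<phi> x" using pu by (auto simp: left_translate_def)
    moreover have "left_translate p \<phi> x \<in> set (map (\<lambda>g. left_translate g \<phi> x) ps)"
      using pu ps by simp
    then have "left_translate p \<phi> x \<le> S x"
      unfolding S_def using assms(2)
      by (intro member_le_sum_list) (auto simp: left_translate_def)
    ultimately have "\<phi> 0 / 2 \<le> S x" by linarith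
    then have "real n * (\<phi> 0 / 2) \<le> real n * S x" by (intro mult_left_mono) auto
    then show ?thesis using n B(2)[of x] by linarith
  next
    case False
    then show ?thesis using K(2) nonneg[of x] by simp
  qed
  then show ?thesis using that[of "concat (replicate n ps)"] sum_rep by simp
qed

section \<open>Continuity of translations as uniform convergence\<close>

text \<open>Convergence for the supremum norm is uniform convergence of the underlying functions,
  and \<open>nhds g\<close> can replace \<open>at g\<close> because the estimate is trivial at
  \<open>g\<close> itself. This turns membership in \<open>Cb_lu\<close> and \<open>Cb_ru\<close>
  into estimates without \<open>Bcontfun\<close>.\<close>

lemma continuous_on_Bcontfun_iff:
  fixes F :: "'b::topological_space \<Rightarrow> 'a::topological_space \<Rightarrow> real"
  assumes "\<And>g. F g \<in> bcontfun"
  shows "continuous_on UNIV (\<lambda>g. Bcontfun (F g)) \<longleftrightarrow> (\<forall>g. uniform_limit UNIV F (F g) (nhds g))"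
proof -
  have ap: "apply_bcontfun (Bcontfun (F g)) = F g" for g
    using Bcontfun_inverse[OF assms] .
  have "((\<lambda>g. Bcontfun (F g)) \<longlongrightarrow> Bcontfun (F g)) (at g) \<longleftrightarrow> uniform_limit UNIV F (F g) (nhds g)" for g
  proof
    assume "((\<lambda>g. Bcontfun (F g)) \<longlongrightarrow> Bcontfun (F g)) (at g)"
    then have "uniform_limit UNIV (\<lambda>g. apply_bcontfun (Bcontfun (F g))) (apply_bcontfun (Bcontfun (F g))) (at g)"
      by (rule tendsto_bcontfun_uniform_limit)
    then show "uniform_limit UNIV F (F g) (nhds g)"
      unfolding uniform_limit_iff eventually_nhds_conv_at ap by simp
  next
    assume "uniform_limit UNIV F (F g) (nhds g)"
    then have "uniform_limit UNIV (\<lambda>g. apply_bcontfun (Bcontfun (F g))) (apply_bcontfun (Bcontfun (F g))) (at g)"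
      unfolding uniform_limit_iff eventually_nhds_conv_at ap by simp
    then show "((\<lambda>g. Bcontfun (F g)) \<longlongrightarrow> Bcontfun (F g)) (at g)"
      by (rule uniform_limit_tendsto_bcontfun)
  qed
  then show ?thesis by (simp add: continuous_on_def)
qed

lemma bcontfun_comp:
  assumes "f \<in> bcontfun" "continuous_on UNIV p"
  shows "(\<lambda>x. f (p x)) \<in> bcontfun"
  using assms continuous_on_UNIV_o[of f UNIV p] unfolding bcontfun_def
  by (auto intro: bounded_subset)

lemma Cb_lu_iff:
  "f \<in> fst Cb_lu \<longleftrightarrow> f \<in> bcontfun \<and> (\<forall>g. uniform_limit UNIV (\<lambda>g x. f (x + g)) (\<lambda>x. f (x + g)) (nhds g))"
  using continuous_on_Bcontfun_iff[of "\<lambda>g. right_translate g f"]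
    bcontfun_comp[OF _ continuous_on_translations(2), of f]
  unfolding Cb_lu_def right_translate_def by auto

lemma Cb_ru_iff:
  "f \<in> fst Cb_ru \<longleftrightarrow> f \<in> bcontfun \<and> (\<forall>g. uniform_limit UNIV (\<lambda>g x. f (- g + x)) (\<lambda>x. f (- g + x)) (nhds g))"
  using continuous_on_Bcontfun_iff[of "\<lambda>g. left_translate g f"]
    bcontfun_comp[OF _ continuous_on_translations(1), of f]
  unfolding Cb_ru_def left_translate_def by auto

lemma Cb_u_add:
  assumes "f \<in> fst Cb_u" "h \<in> fst Cb_u"
  shows "(\<lambda>x. f x + h x) \<in> fst Cb_u"
  using assms unfolding Cb_u_def fst_conv Int_iff Cb_lu_iff Cb_ru_iff
  by (auto intro!: plus_cont uniform_limit_add)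

text \<open>Joint continuity gives closeness that is uniform on the compact set \<open>L\<close>;
  off \<open>L\<close> both functions vanish.\<close>

lemma uniform_limit_compact_support:
  fixes F :: "'b::topological_space \<Rightarrow> 'a::topological_space \<Rightarrow> real"
  assumes cont: "continuous_on UNIV (\<lambda>(g, x). F g x)"
    and L: "compact L" and supp: "\<forall>\<^sub>F g in nhds g0. \<forall>x. x \<notin> L \<longrightarrow> F g x = 0"
  shows "uniform_limit UNIV F (F g0) (nhds g0)"
proof (rule uniform_limitI)
  fix e :: real assume "e > 0"
  have "e / 2 > 0" using \<open>e > 0\<close> by simp
  from continuous_on_prod_compactE[OF continuous_on_subset[OF cont subset_UNIV] L UNIV_I this, of g0]
  obtain X where X: "g0 \<in> X" "open X" "\<forall>g\<in>X \<inter> UNIV. \<forall>x\<in>L. dist (F g x) (F g0 x) \<le> e / 2"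
    unfolding prod.case by metis
  have 1: "\<forall>\<^sub>F g in nhds g0. g \<in> X" using X by (simp add: eventually_nhds_in_open)
  have 0: "\<forall>x. x \<notin> L \<longrightarrow> F g0 x = 0" using eventually_nhds_x_imp_x[OF supp] .
  show "\<forall>\<^sub>F g in nhds g0. \<forall>x\<in>UNIV. dist (F g x) (F g0 x) < e"
    using 1 supp
  proof eventually_elim
    case (elim g)
    show ?case
    proof
      fix x show "dist (F g x) (F g0 x) < e"
        using elim X(3) 0 \<open>e > 0\<close> by (cases "x \<in> L") force+
    qed
  qed
qed

lemma Hausdorff_space_t2: "Hausdorff_space (euclidean :: 'a::t2_space topology)"
  unfolding Hausdorff_space_def disjnt_def using hausdorff by simp blast

section \<open>Haar integrals and convolution\<close>

locale haar_group =
  fixes m :: "'a::{topological_group_add,t2_space} measure"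
  assumes locally_compact: "locally_compact_space (euclidean :: 'a topology)"
    and haar: "left_haar_measure m"
begin

section \<open>Urysohn functions and translates of compactly supported functions\<close>

lemma compact_neighbourhood:
  fixes K :: "'a set"
  assumes "compact K"
  obtains U L where "open U" "compact L" "K \<subseteq> U" "U \<subseteq> L"
proof -
  have "\<exists>U L. openin euclidean U \<and> compactin euclidean L \<and> closedin euclidean L \<and> K \<subseteq> U \<and> U \<subseteq> L"
    using locally_compact_space_compact_closed_compact[THEN iffD1, OF disjI1[OF Hausdorff_space_t2] locally_compact]
      assms unfolding compactin_euclidean_iff by blast
  then show ?thesis using that unfolding compactin_euclidean_iff open_openin[symmetric] by blast
qed

text \<open>A locally compact Hausdorff space is completely regular. The closed set separated from
  \<open>K\<close> is the complement of \<open>U \<inter> V\<close> instead of that of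
  \<open>U\<close>: as \<open>V\<close> lies in the compact set \<open>L\<close>, the function
  vanishes off \<open>L\<close>.\<close>

lemma Urysohn_Cc:
  fixes K U :: "'a set"
  assumes "compact K" "open U" "K \<subseteq> U"
  obtains f where "f \<in> Cc" "\<And>x. 0 \<le> f x" "\<And>x. x \<in> K \<Longrightarrow> f x = 1" "\<And>x. x \<notin> U \<Longrightarrow> f x = 0"
proof -
  obtain V L where VL: "open V" "compact L" "K \<subseteq> V" "V \<subseteq> L"
    using compact_neighbourhood[OF assms(1)] .
  have cr: "completely_regular_space (euclidean :: 'a topology)"
    by (rule locally_compact_regular_imp_completely_regular_space[OF locally_compact])
      (simp add: Hausdorff_space_t2)
  have cl: "closedin euclidean (- (U \<inter> V))"
    unfolding closed_closedin[symmetric] using assms(2) VL(1) by (intro closed_Compl open_Int)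
  have "disjnt K (- (U \<inter> V))"
    using assms(3) VL(3) by (auto simp: disjnt_def)
  then obtain f where f: "continuous_map euclidean (top_of_set {0..1::real}) f"
      "f ` (- (U \<inter> V)) \<subseteq> {0}" "f ` K \<subseteq> {1}"
    using Urysohn_completely_regular_compact_closed[OF zero_le_one cr _ cl, of K] assms(1)
    by auto
  show ?thesis
  proof
    show "f \<in> Cc"
    proof (rule CcI[OF _ VL(2)])
      show "continuous_on UNIV f"
        using f(1) by (auto simp: continuous_map_in_subtopology)
      show "f x = 0" if "x \<notin> L" for x using that f(2) VL(4) by fast
    qed
    show "0 \<le> f x" for x
      using f(1) by (auto simp: continuous_map_in_subtopology Pi_iff)
    show "f x = 1" if "x \<in> K" for x using f(3) that by auto
    show "f x = 0" if "x \<notin> U" for x using f(2) that by fast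
  qed
qed

text \<open>For \<open>g\<close> in a compact neighbourhood \<open>C\<close> of \<open>g0\<close>,
  all the translates vanish off the single compact set \<open>C + K\<close>. This common set is part
  of the conclusion because \<open>L1_continuous\<close> integrates over it.\<close>

lemma uniform_limit_translate:
  fixes \<phi> :: "'a \<Rightarrow> real"
  assumes "\<phi> \<in> Cc"
  obtains L where "compact L" "\<forall>\<^sub>F g in nhds g0. \<forall>x. x \<notin> L \<longrightarrow> \<phi> (- g + x) = 0"
    "uniform_limit UNIV (\<lambda>g x. \<phi> (- g + x)) (\<lambda>x. \<phi> (- g0 + x)) (nhds g0)"
proof -
  obtain K where K: "compact K" "\<And>x. x \<notin> K \<Longrightarrow> \<phi> x = 0"
    using CcE[OF assms] by blast
  obtain U C where C: "open U" "compact C" "{g0} \<subseteq> U" "U \<subseteq> C"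
    using compact_neighbourhood[of "{g0}"] by auto
  let ?L = "(\<lambda>(x, y). x + y) ` (C \<times> K)"
  have "\<phi> (- g + x) = 0" if "g \<in> U" "x \<notin> ?L" for g x
  proof -
    have "- g + x \<notin> K"
    proof
      assume "- g + x \<in> K"
      then have "(\<lambda>(x, y). x + y) (g, - g + x) \<in> ?L"
        using that C(4) by (intro imageI) auto
      then show False using that by (simp add: add.assoc[symmetric])
    qed
    then show ?thesis by (rule K(2))
  qed
  moreover have "\<forall>\<^sub>F g in nhds g0. g \<in> U"
    using C by (simp add: eventually_nhds_in_open)
  ultimately have ev: "\<forall>\<^sub>F g in nhds g0. \<forall>x. x \<notin> ?L \<longrightarrow> \<phi> (- g + x) = 0"
    by (auto elim!: eventually_mono)
  have L: "compact ?L" by (rule compact_add[OF C(2) K(1)])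
  have "continuous_on UNIV (\<lambda>p::'a \<times> 'a. - fst p + snd p)"
    unfolding continuous_on_def by (intro ballI tendsto_add tendsto_minus tendsto_fst tendsto_snd tendsto_ident_at)
  then have "continuous_on UNIV (\<lambda>(g, x). \<phi> (- g + x))"
    using continuous_on_UNIV_o[OF Cc_continuous[OF assms]] by (simp add: case_prod_unfold)
  from uniform_limit_compact_support[OF this L ev] show ?thesis
    using that[OF L ev] by simp
qed

section \<open>The Haar measure and its integral\<close>

lemma sets_m [measurable_cong]: "sets m = sets borel"
  and space_m: "space m = UNIV"
  and measurable_m: "measurable m = measurable borel"
  and emeasure_compact: "compact K \<Longrightarrow> emeasure m K < \<infinity>"
  and emeasure_translate: "A \<in> sets borel \<Longrightarrow> emeasure m ((+) g ` A) = emeasure m A"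
  and inner_regular: "A \<in> sets borel \<Longrightarrow>
     emeasure m A = (SUP K\<in>{K. K \<subseteq> A \<and> compact K}. emeasure m K)"
  and emeasure_UNIV: "emeasure m UNIV \<noteq> 0"
proof -
  note * = haar[unfolded left_haar_measure_def, THEN conjunct2]
  show 1: "sets m = sets borel" using haar by (simp only: left_haar_measure_def)
  then show "space m = UNIV" using sets_eq_imp_space_eq[of m borel] by simp
  show "measurable m = measurable borel"
    by (intro ext measurable_cong_sets 1 refl)
  show "emeasure m UNIV \<noteq> 0" using *[THEN conjunct1] .
  show "compact K \<Longrightarrow> emeasure m K < \<infinity>"
    using *[THEN conjunct2, THEN conjunct1] by (elim allE impE)
  show "A \<in> sets borel \<Longrightarrow> emeasure m A = (SUP K\<in>{K. K \<subseteq> A \<and> compact K}. emeasure m K)"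
    using *[THEN conjunct2, THEN conjunct2, THEN conjunct1] by (elim ballE) auto
  show "A \<in> sets borel \<Longrightarrow> emeasure m ((+) g ` A) = emeasure m A"
    using *[THEN conjunct2, THEN conjunct2, THEN conjunct2] by (elim allE ballE) auto
qed

lemma exists_compact_subset:
  assumes "A \<in> sets borel" "emeasure m A \<noteq> 0"
  obtains K where "compact K" "K \<subseteq> A" "emeasure m K \<noteq> 0"
proof -
  have "\<exists>K\<in>{K. K \<subseteq> A \<and> compact K}. emeasure m K \<noteq> 0"
  proof (rule ccontr)
    assume "\<not> ?thesis"
    then have "(SUP K\<in>{K. K \<subseteq> A \<and> compact K}. emeasure m K) \<le> 0"
      by (intro SUP_least) auto
    then show False using inner_regular[OF assms(1)] assms(2) by simp
  qed
  then show ?thesis using that by blast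
qed

text \<open>Move \<open>U\<close> to a neighbourhood of the identity. If it were null, so would be a
  finite union of its translates that covers a compact set of positive measure, and such a compact
  set exists by inner regularity.\<close>

lemma emeasure_open:
  assumes "open U" "U \<noteq> {}"
  shows "emeasure m U \<noteq> 0"
proof
  assume zero: "emeasure m U = 0"
  obtain u where u: "u \<in> U" using assms(2) by blast
  let ?V = "(+) (- u) ` U"
  have V: "open ?V" "0 \<in> ?V"
    using open_translate[OF assms(1)] u by (auto intro!: image_eqI[of _ _ u])
  have Vz: "emeasure m ?V = 0" using emeasure_translate zero assms(1) by simp
  obtain K where K: "compact K" "emeasure m K \<noteq> 0"
    using exists_compact_subset[of UNIV] emeasure_UNIV by auto
  obtain P where P: "finite P" "K \<subseteq> (\<Union>p\<in>P. (+) p ` ?V)"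
    using compact_cover_translates[OF K(1) V] by metis
  have "(+) p ` ?V \<in> null_sets m" for p
    using emeasure_translate[of ?V p] open_translate[OF V(1), of p] V Vz by (auto simp: null_sets_def sets_m)
  then have N: "(\<Union>p\<in>P. (+) p ` ?V) \<in> null_sets m"
    using P(1) by (intro null_sets_UN') (auto intro: countable_finite)
  have "K \<in> sets m" using K(1) by (simp add: sets_m borel_compact)
  then have "emeasure m K = 0" using null_sets_subset[OF N] P(2) by (auto simp: null_sets_def)
  then show False using K(2) by simp
qed

lemma distr_translate: "distr m borel ((+) g) = m"
proof (rule measure_eqI)
  show "sets (distr m borel ((+) g)) = sets m" by (simp add: sets_m)
  fix A assume "A \<in> sets (distr m borel ((+) g))"
  then have A: "A \<in> sets borel" by simp
  have meas: "(+) g \<in> borel_measurable m"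
    unfolding measurable_m by (intro borel_measurable_continuous_onI continuous_on_translations)
  have "(+) g -` A = (+) (- g) ` A"
    by (auto simp: image_iff add.assoc[symmetric]) (metis add.assoc add.right_neutral add_0 left_minus)
  then show "emeasure (distr m borel ((+) g)) A = emeasure m A"
    using emeasure_distr[OF meas A] emeasure_translate[OF A, of "- g"] by (simp add: space_m)
qed

lemma translate_measurable [measurable]: "(+) g \<in> measurable m borel"
  unfolding measurable_m by (intro borel_measurable_continuous_onI continuous_on_translations)

lemma integral_translate:
  fixes F :: "'a \<Rightarrow> real"
  assumes "F \<in> borel_measurable borel"
  shows "(\<integral>x. F (g + x) \<partial>m) = (\<integral>x. F x \<partial>m)"
  using integral_distr[OF translate_measurable assms, of g] by (simp add: distr_translate)

lemma integrable_translate: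
  fixes F :: "'a \<Rightarrow> real"
  assumes "F \<in> borel_measurable borel"
  shows "integrable m (\<lambda>x. F (g + x)) \<longleftrightarrow> integrable m F"
  using integrable_distr_eq[OF translate_measurable assms, of g] by (simp add: distr_translate)

lemma compact_support_integrable:
  fixes F :: "'a \<Rightarrow> real"
  assumes F: "F \<in> borel_measurable borel" and K: "compact K"
    and supp: "\<And>x. x \<notin> K \<Longrightarrow> F x = 0" and B: "\<And>x. \<bar>F x\<bar> \<le> B"
  shows "integrable m F" "(\<integral>x. \<bar>F x\<bar> \<partial>m) \<le> B * measure m K"
proof -
  have Ks: "K \<in> sets m" using K by (simp add: sets_m borel_compact)
  have i: "integrable m (\<lambda>x. B * indicator K x)"
    using emeasure_compact[OF K] Ks by (intro integrable_mult_right integrable_real_indicator) auto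
  have "\<bar>F x\<bar> \<le> B * indicator K x" for x
    using supp[of x] B[of x] by (auto simp: indicator_def)
  then show I: "integrable m F"
    using F by (intro Bochner_Integration.integrable_bound[OF i])
      (auto simp: measurable_m intro!: AE_I2 intro: order_trans[OF _ abs_ge_self])
  have "(\<integral>x. \<bar>F x\<bar> \<partial>m) \<le> (\<integral>x. B * indicator K x \<partial>m)"
    using I i \<open>\<And>x. \<bar>F x\<bar> \<le> B * indicator K x\<close> by (intro integral_mono) auto
  also have "\<dots> = B * measure m K" using Ks by simp
  finally show "(\<integral>x. \<bar>F x\<bar> \<partial>m) \<le> B * measure m K" .
qed

lemma Cc_bounded_integrable:
  fixes h :: "'a \<Rightarrow> real"
  assumes "\<phi> \<in> Cc" "h \<in> borel_measurable borel" "bounded (range h)"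
  shows "integrable m (\<lambda>x. \<phi> x * h x)"
proof -
  obtain K where K: "compact K" "\<And>x. x \<notin> K \<Longrightarrow> \<phi> x = 0" using CcE[OF assms(1)] by blast
  obtain B where B: "B > 0" "\<And>x. \<bar>\<phi> x\<bar> \<le> B" using Cc_bound[OF assms(1)] by blast
  obtain M where M: "\<And>x. \<bar>h x\<bar> \<le> M" using assms(3) unfolding bounded_iff by auto
  show ?thesis
  proof (rule compact_support_integrable(1)[OF _ K(1)])
    show "\<bar>\<phi> x * h x\<bar> \<le> B * M" for x
      unfolding abs_mult by (intro mult_mono B M) (use B in auto)
    show "(\<lambda>x. \<phi> x * h x) \<in> borel_measurable borel"
      by (intro borel_measurable_times Cc_borel assms)
  qed (use K in auto)
qed

lemma Cc_integrable: "\<phi> \<in> Cc \<Longrightarrow> integrable m \<phi>"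
  using Cc_bounded_integrable[of \<phi> "\<lambda>_. 1"] by simp

text \<open>The set where \<open>F\<close> is positive is open and contains \<open>x0\<close>, hence
  it is not null.\<close>

lemma integral_pos:
  fixes F :: "'a \<Rightarrow> real"
  assumes "continuous_on UNIV F" "integrable m F" "\<And>x. 0 \<le> F x" "0 < F x0"
  shows "0 < (\<integral>x. F x \<partial>m)"
proof -
  let ?U = "{x. 0 < F x}"
  have U: "open ?U" "?U \<noteq> {}"
    using assms(1,4) by (auto intro!: open_Collect_less continuous_intros)
  have "\<not> (AE x in m. F x = 0)"
  proof
    assume "AE x in m. F x = 0"
    then have "AE x in m. x \<notin> ?U" by eventually_elim auto
    then have "?U \<in> null_sets m" using U(1) by (subst (asm) AE_iff_null) (auto simp: sets_m space_m)
    then show False using emeasure_open[OF U] by auto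
  qed
  then have "(\<integral>x. F x \<partial>m) \<noteq> 0"
    using integral_nonneg_eq_0_iff_AE[OF assms(2)] assms(3) by auto
  moreover have "0 \<le> (\<integral>x. F x \<partial>m)" using assms(3) by simp
  ultimately show ?thesis by linarith
qed

text \<open>Translates by elements near \<open>g0\<close> are uniformly close and vanish off a
  common compact set, which has finite measure. Hence they are close in the L1 norm.\<close>

lemma L1_continuous:
  fixes \<phi> :: "'a \<Rightarrow> real"
  assumes "\<phi> \<in> Cc"
  shows "((\<lambda>g. \<integral>x. \<bar>\<phi> (- g + x) - \<phi> (- g0 + x)\<bar> \<partial>m) \<longlongrightarrow> 0) (nhds g0)"
proof (rule tendstoI)
  fix e :: real assume e: "e > 0"
  obtain L where L: "compact L" and ev: "\<forall>\<^sub>F g in nhds g0. \<forall>x. x \<notin> L \<longrightarrow> \<phi> (- g + x) = 0"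
    and ul: "uniform_limit UNIV (\<lambda>g x. \<phi> (- g + x)) (\<lambda>x. \<phi> (- g0 + x)) (nhds g0)"
    using uniform_limit_translate[OF assms, of g0] by blast
  have 0: "\<forall>x. x \<notin> L \<longrightarrow> \<phi> (- g0 + x) = 0" using eventually_nhds_x_imp_x[OF ev] .
  \<comment> \<open>Adding 1 keeps the denominator positive when \<open>L\<close> is null.\<close>
  define d where "d = e / (measure m L + 1)"
  have pos: "measure m L + 1 > 0" using measure_nonneg[of m L] by linarith
  have d: "d > 0" "d * measure m L < e"
    using e pos by (auto simp: d_def field_simps)
  show "\<forall>\<^sub>F g in nhds g0. dist (\<integral>x. \<bar>\<phi> (- g + x) - \<phi> (- g0 + x)\<bar> \<partial>m) 0 < e"
    using ev uniform_limitD[OF ul d(1)]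
  proof eventually_elim
    case (elim g)
    have "(\<integral>x. \<bar>\<phi> (- g + x) - \<phi> (- g0 + x)\<bar> \<partial>m) \<le> d * measure m L"
    proof (rule compact_support_integrable(2)[OF _ L])
      show "(\<lambda>x. \<phi> (- g + x) - \<phi> (- g0 + x)) \<in> borel_measurable borel"
        by (intro borel_measurable_diff Cc_borel Cc_translate assms)
      show "\<phi> (- g + x) - \<phi> (- g0 + x) = 0" if "x \<notin> L" for x
        using elim(1) 0 that by simp
      show "\<bar>\<phi> (- g + x) - \<phi> (- g0 + x)\<bar> \<le> d" for x
        using elim(2)[rule_format, of x] by (simp add: dist_real_def)
    qed
    then show ?case using d(2) by simp
  qed
qed

section \<open>Convolution: substitutions, linearity and domination\<close>

text \<open>In multiplicative notation \<open>k\<close> is evaluated at s^{-1}x. The Bochner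
  integral is 0 for an integrand that is not integrable, which is why the additivity lemmas ask for
  integrability.\<close>

definition conv :: "('a \<Rightarrow> real) \<Rightarrow> ('a \<Rightarrow> real) \<Rightarrow> 'a \<Rightarrow> real" where
  "conv h k x = (\<integral>s. h s * k (- s + x) \<partial>m)"

lemma borel_reflect:
  fixes k :: "'a \<Rightarrow> real"
  assumes "k \<in> borel_measurable borel"
  shows "(\<lambda>s. k (- s + x)) \<in> borel_measurable borel" "(\<lambda>s. k (x + s)) \<in> borel_measurable borel"
proof -
  have "(\<lambda>s. - s + x) \<in> borel_measurable borel" "(\<lambda>s. x + s) \<in> borel_measurable borel"
    by (intro borel_measurable_continuous_onI continuous_on_translations)+
  then show "(\<lambda>s. k (- s + x)) \<in> borel_measurable borel" "(\<lambda>s. k (x + s)) \<in> borel_measurable borel"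
    using assms by (auto intro: measurable_compose)
qed

lemma bounded_comp: "bounded (range (k :: 'a \<Rightarrow> real)) \<Longrightarrow> bounded (range (\<lambda>s. k (p s)))"
  by (rule bounded_subset) auto

lemma Cc_reflect:
  fixes k :: "'a \<Rightarrow> real"
  assumes "k \<in> Cc" shows "(\<lambda>s. k (- s + x)) \<in> Cc"
  using Cc_translate(3)[OF Cc_translate(2)[OF assms, of x]] .

text \<open>By left invariance, \<open>g + s\<close> may be substituted for \<open>s\<close>, so
  that a translation of the first factor passes outside.\<close>

lemma conv_left_translate:
  assumes "h \<in> borel_measurable borel" "k \<in> borel_measurable borel"
  shows "conv (left_translate g h) k = left_translate g (conv h k)"
proof
  fix x
  have "conv (left_translate g h) k x = (\<integral>s. h (- g + s) * k (- s + x) \<partial>m)"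
    by (simp add: conv_def left_translate_def)
  also have "\<dots> = (\<integral>s. h (- g + (g + s)) * k (- (g + s) + x) \<partial>m)"
    by (rule integral_translate[symmetric]) (intro borel_measurable_times borel_reflect assms)
  also have "\<dots> = left_translate g (conv h k) x"
    by (simp add: conv_def left_translate_def minus_add add.assoc[symmetric])
  finally show "conv (left_translate g h) k x = left_translate g (conv h k) x" .
qed

text \<open>Substituting \<open>x + s\<close> for \<open>s\<close> moves \<open>x\<close> into the
  first factor. A translation of the convolution, on either side, then varies only one of the two
  factors.\<close>

lemma conv_translate:
  assumes "h \<in> borel_measurable borel" "k \<in> borel_measurable borel"
  shows "conv h k (x + y) = (\<integral>s. h (x + s) * k (- s + y) \<partial>m)"
proof -
  have "conv h k (x + y) = (\<integral>s. h (x + s) * k (- (x + s) + (x + y)) \<partial>m)"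
    unfolding conv_def
    by (rule integral_translate[symmetric]) (intro borel_measurable_times borel_reflect assms)
  moreover have "- (x + s) + (x + y) = - s + y" for s
    by (simp only: minus_add add.assoc minus_add_cancel)
  ultimately show ?thesis by simp
qed

lemma conv_add_left:
  assumes "integrable m (\<lambda>s. h s * k (- s + x))" "integrable m (\<lambda>s. h' s * k (- s + x))"
  shows "conv (\<lambda>s. h s + h' s) k x = conv h k x + conv h' k x"
  using assms by (simp add: conv_def distrib_right)

lemma conv_add_right:
  assumes "integrable m (\<lambda>s. h s * k (- s + x))" "integrable m (\<lambda>s. h s * k' (- s + x))"
  shows "conv h (\<lambda>s. k s + k' s) x = conv h k x + conv h k' x"
  using assms by (simp add: conv_def distrib_left)

lemma conv_cmult: "conv (\<lambda>s. c * h s) k x = c * conv h k x" "conv h (\<lambda>s. c * k s) x = c * conv h k x"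
  by (simp_all add: conv_def mult.assoc mult.left_commute)

lemma conv_cong_AE:
  assumes "h \<in> borel_measurable borel" "h' \<in> borel_measurable borel" "k \<in> borel_measurable borel"
    and "AE s in m. h s = h' s"
  shows "conv h k = conv h' k"
proof
  fix x show "conv h k x = conv h' k x"
    unfolding conv_def
  proof (rule integral_cong_AE)
    show "AE s in m. h s * k (- s + x) = h' s * k (- s + x)" using assms(4) by eventually_elim simp
  qed (unfold measurable_m, (intro borel_measurable_times borel_reflect assms)+)
qed

lemma integrable_conv_translate:
  assumes "h \<in> borel_measurable borel" "k \<in> borel_measurable borel"
    and "\<And>x. integrable m (\<lambda>s. h s * k (- s + x))"
  shows "integrable m (\<lambda>s. left_translate g h s * k (- s + x))"
proof -
  have "integrable m (\<lambda>s. left_translate g h s * k (- s + x)) \<longleftrightarrow>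
     integrable m (\<lambda>s. left_translate g h (g + s) * k (- (g + s) + x))"
    unfolding left_translate_def
    by (rule integrable_translate[symmetric]) (intro borel_measurable_times borel_reflect assms)
  also have "(\<lambda>s. left_translate g h (g + s) * k (- (g + s) + x)) = (\<lambda>s. h s * k (- s + (- g + x)))"
    by (simp add: left_translate_def minus_add add.assoc)
      (simp add: add.assoc[symmetric])
  finally show ?thesis using assms(3) by simp
qed

text \<open>Both parts are proved in one induction because additivity at each step needs the
  integrability for the tail of the list.\<close>

lemma conv_sum_list_translate:
  assumes f: "f \<in> borel_measurable borel" and k: "k \<in> borel_measurable borel"
    and int: "\<And>x. integrable m (\<lambda>s. f s * k (- s + x))"
  shows "integrable m (\<lambda>s. (\<Sum>g\<leftarrow>gs. left_translate g f s) * k (- s + x)) \<and>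
    conv (\<lambda>s. \<Sum>g\<leftarrow>gs. left_translate g f s) k x = (\<Sum>g\<leftarrow>gs. left_translate g (conv f k) x)"
proof (induction gs)
  case Nil
  then show ?case by (simp add: conv_def)
next
  case (Cons g gs)
  have 1: "integrable m (\<lambda>s. left_translate g f s * k (- s + x))"
    by (rule integrable_conv_translate[OF f k int])
  show ?case
    using Cons 1 conv_add_left[OF 1 conjunct1[OF Cons]] conv_left_translate[OF f k, of g]
    by (simp add: distrib_right)
qed

text \<open>Since \<open>k\<close> is non-negative, the domination can be integrated against it, and
  the translations then pass outside. In \<open>property_L_infty\<close> the compactly supported
  factor is \<open>k\<close>; in \<open>property_Cb_lu\<close> it is the dominating
  function.\<close>

lemma conv_dominated:
  assumes f: "f \<in> borel_measurable borel" and k: "k \<in> borel_measurable borel" "\<And>x. 0 \<le> k x"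
    and int: "\<And>x. integrable m (\<lambda>s. f s * k (- s + x))" "\<And>x. integrable m (\<lambda>s. h s * k (- s + x))"
    and dom: "AE s in m. \<bar>h s\<bar> \<le> (\<Sum>g\<leftarrow>gs. left_translate g f s)"
  shows "\<bar>conv h k x\<bar> \<le> (\<Sum>g\<leftarrow>gs. left_translate g (conv f k) x)"
proof -
  have "\<bar>conv h k x\<bar> \<le> (\<integral>s. \<bar>h s * k (- s + x)\<bar> \<partial>m)"
    unfolding conv_def by (rule integral_abs_bound)
  also have "\<dots> \<le> (\<integral>s. (\<Sum>g\<leftarrow>gs. left_translate g f s) * k (- s + x) \<partial>m)"
  proof (rule integral_mono_AE)
    show "integrable m (\<lambda>s. \<bar>h s * k (- s + x)\<bar>)" using int(2) by simp
    show "integrable m (\<lambda>s. (\<Sum>g\<leftarrow>gs. left_translate g f s) * k (- s + x))"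
      using conv_sum_list_translate[OF f k(1) int(1)] by blast
    show "AE s in m. \<bar>h s * k (- s + x)\<bar> \<le> (\<Sum>g\<leftarrow>gs. left_translate g f s) * k (- s + x)"
      using dom by eventually_elim (auto simp: abs_mult k intro: mult_right_mono)
  qed
  also have "\<dots> = (\<Sum>g\<leftarrow>gs. left_translate g (conv f k) x)"
    using conv_sum_list_translate[OF f k(1) int(1)] by (simp add: conv_def)
  finally show ?thesis .
qed

section \<open>Continuity and supports of convolutions\<close>

text \<open>Uniformly in \<open>x\<close>, the difference is at most a bound \<open>M\<close> of
  \<open>k\<close> times the L1 distance of two left translates of \<open>h\<close>.\<close>

lemma conv_left_uniform:
  fixes h k :: "'a \<Rightarrow> real"
  assumes h: "h \<in> Cc" and k: "k \<in> borel_measurable borel" "bounded (range k)"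
  shows "uniform_limit UNIV (\<lambda>g x. conv h k (- g + x)) (\<lambda>x. conv h k (- g0 + x)) (nhds g0)"
proof (rule uniform_limitI)
  fix e :: real assume e: "e > 0"
  obtain M where M: "M > 0" "\<And>x. \<bar>k x\<bar> \<le> M" using k(2) unfolding bounded_pos by auto
  have kx: "bounded (range (\<lambda>s. k (- s + x)))" for x by (rule bounded_comp[OF k(2)])
  have int: "integrable m (\<lambda>s. h (- g + s) * k (- s + x))" for g x
    by (rule Cc_bounded_integrable[OF Cc_translate(1)[OF h] borel_reflect(1)[OF k(1)] kx])
  have intd: "integrable m (\<lambda>s. \<bar>h (- g + s) - h (- g0 + s)\<bar>)" for g
    by (intro integrable_abs Bochner_Integration.integrable_diff Cc_integrable Cc_translate h)
  have "\<bar>conv h k (- g + x) - conv h k (- g0 + x)\<bar> \<le> M * (\<integral>s. \<bar>h (- g + s) - h (- g0 + s)\<bar> \<partial>m)" for g x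
  proof -
    have "conv h k (- g + x) - conv h k (- g0 + x)
        = (\<integral>s. h (- g + s) * k (- s + x) - h (- g0 + s) * k (- s + x) \<partial>m)"
      unfolding Bochner_Integration.integral_diff[OF int int]
        conv_translate[OF Cc_borel[OF h] k(1)] ..
    then have "\<bar>conv h k (- g + x) - conv h k (- g0 + x)\<bar> \<le> (\<integral>s. \<bar>h (- g + s) * k (- s + x) - h (- g0 + s) * k (- s + x)\<bar> \<partial>m)"
      by (simp only: integral_abs_bound)
    also have "\<dots> \<le> (\<integral>s. M * \<bar>h (- g + s) - h (- g0 + s)\<bar> \<partial>m)"
    proof (rule integral_mono)
      show "\<bar>h (- g + s) * k (- s + x) - h (- g0 + s) * k (- s + x)\<bar> \<le> M * \<bar>h (- g + s) - h (- g0 + s)\<bar>" for s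
        unfolding left_diff_distrib[symmetric] abs_mult by (subst mult.commute) (intro mult_right_mono M abs_ge_zero)
    qed (intro integrable_abs Bochner_Integration.integrable_diff int integrable_mult_right intd)+
    finally show ?thesis by simp
  qed
  note bound = this
  have "\<forall>\<^sub>F g in nhds g0. dist (\<integral>s. \<bar>h (- g + s) - h (- g0 + s)\<bar> \<partial>m) 0 < e / M"
    using tendstoD[OF L1_continuous[OF h]] e M(1) by simp
  then show "\<forall>\<^sub>F g in nhds g0. \<forall>x\<in>UNIV. dist (conv h k (- g + x)) (conv h k (- g0 + x)) < e"
  proof eventually_elim
    case (elim g)
    then have "M * (\<integral>s. \<bar>h (- g + s) - h (- g0 + s)\<bar> \<partial>m) < e"
      using M(1) by (simp add: field_simps)
    then show ?case unfolding dist_real_def by (intro ballI le_less_trans[OF bound])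
  qed
qed

lemma conv_right_uniform:
  fixes h k :: "'a \<Rightarrow> real"
  assumes k: "k \<in> Cc" and h: "h \<in> borel_measurable borel" "bounded (range h)"
  shows "uniform_limit UNIV (\<lambda>g x. conv h k (x + g)) (\<lambda>x. conv h k (x + g0)) (nhds g0)"
proof (rule uniform_limitI)
  fix e :: real assume e: "e > 0"
  obtain M where M: "M > 0" "\<And>x. \<bar>h x\<bar> \<le> M" using h(2) unfolding bounded_pos by auto
  have hx: "bounded (range (\<lambda>s. h (x + s)))" for x by (rule bounded_comp[OF h(2)])
  have int: "integrable m (\<lambda>s. h (x + s) * k (- s + g))" for g x
    using Cc_bounded_integrable[OF Cc_reflect[OF k] borel_reflect(2)[OF h(1)] hx] by (simp add: mult.commute)
  \<comment> \<open>After reflection, the dependence on \<open>g\<close> in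
    \<open>k (- s + g)\<close> is a left translation of \<psi>, to which
    \<open>L1_continuous\<close> applies.\<close>
  define \<psi> where "\<psi> s = k (- s)" for s
  have \<psi>: "\<psi> \<in> Cc" unfolding \<psi>_def by (rule Cc_translate(3)[OF k])
  have \<psi>k: "k (- s + g) = \<psi> (- g + s)" for s g by (simp add: \<psi>_def minus_add)
  have intd: "integrable m (\<lambda>s. \<bar>\<psi> (- g + s) - \<psi> (- g0 + s)\<bar>)" for g
    by (intro integrable_abs Bochner_Integration.integrable_diff Cc_integrable Cc_translate \<psi>)
  have "\<bar>conv h k (x + g) - conv h k (x + g0)\<bar> \<le> M * (\<integral>s. \<bar>\<psi> (- g + s) - \<psi> (- g0 + s)\<bar> \<partial>m)" for g x
  proof -
    have "conv h k (x + g) - conv h k (x + g0)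
        = (\<integral>s. h (x + s) * k (- s + g) - h (x + s) * k (- s + g0) \<partial>m)"
      unfolding Bochner_Integration.integral_diff[OF int int]
        conv_translate[OF h(1) Cc_borel[OF k]] ..
    then have "\<bar>conv h k (x + g) - conv h k (x + g0)\<bar> \<le> (\<integral>s. \<bar>h (x + s) * k (- s + g) - h (x + s) * k (- s + g0)\<bar> \<partial>m)"
      by (simp only: integral_abs_bound)
    also have "\<dots> \<le> (\<integral>s. M * \<bar>\<psi> (- g + s) - \<psi> (- g0 + s)\<bar> \<partial>m)"
    proof (rule integral_mono)
      show "\<bar>h (x + s) * k (- s + g) - h (x + s) * k (- s + g0)\<bar> \<le> M * \<bar>\<psi> (- g + s) - \<psi> (- g0 + s)\<bar>" for s
        unfolding right_diff_distrib[symmetric] abs_mult \<psi>k by (intro mult_right_mono M abs_ge_zero)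
    qed (intro integrable_abs Bochner_Integration.integrable_diff int integrable_mult_right intd)+
    finally show ?thesis by simp
  qed
  note bound = this
  have "\<forall>\<^sub>F g in nhds g0. dist (\<integral>s. \<bar>\<psi> (- g + s) - \<psi> (- g0 + s)\<bar> \<partial>m) 0 < e / M"
    using tendstoD[OF L1_continuous[OF \<psi>]] e M(1) by simp
  then show "\<forall>\<^sub>F g in nhds g0. \<forall>x\<in>UNIV. dist (conv h k (x + g)) (conv h k (x + g0)) < e"
  proof eventually_elim
    case (elim g)
    then have "M * (\<integral>s. \<bar>\<psi> (- g + s) - \<psi> (- g0 + s)\<bar> \<partial>m) < e"
      using M(1) by (simp add: field_simps)
    then show ?case unfolding dist_real_def by (intro ballI le_less_trans[OF bound])
  qed
qed

lemma conv_Cc_bcontfun: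
  fixes h k :: "'a \<Rightarrow> real"
  assumes h: "h \<in> Cc" and k: "k \<in> borel_measurable borel" "bounded (range k)"
  shows "conv h k \<in> bcontfun"
proof -
  obtain M where M: "M > 0" "\<And>x. \<bar>k x\<bar> \<le> M" using k(2) unfolding bounded_pos by auto
  have "isCont (conv h k) x" for x
  proof -
    \<comment> \<open>Continuity at \<open>x\<close> is the uniform statement at
      \<open>g0 = - x\<close>, evaluated at the point 0. Inversion then leads back from
      \<open>- x\<close> to \<open>x\<close>.\<close>
    have "((\<lambda>g. conv h k (- g + 0)) \<longlongrightarrow> conv h k (- (- x) + 0)) (nhds (- x))"
      by (rule tendsto_uniform_limitI[OF conv_left_uniform[OF assms]]) simp
    then have "((\<lambda>g. conv h k (- g)) \<longlongrightarrow> conv h k x) (nhds (- x))" by simp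
    then have "((\<lambda>y. conv h k (- (- y))) \<longlongrightarrow> conv h k x) (at x)"
      by (rule filterlim_compose) (intro tendsto_minus tendsto_ident_at)
    then show ?thesis by (simp add: isCont_def)
  qed
  moreover have "\<bar>conv h k x\<bar> \<le> (\<integral>s. M * \<bar>h s\<bar> \<partial>m)" for x
  proof -
    have "\<bar>conv h k x\<bar> \<le> (\<integral>s. \<bar>h s * k (- s + x)\<bar> \<partial>m)" unfolding conv_def by (rule integral_abs_bound)
    also have "\<dots> \<le> (\<integral>s. M * \<bar>h s\<bar> \<partial>m)"
    proof (rule integral_mono)
      show "integrable m (\<lambda>s. \<bar>h s * k (- s + x)\<bar>)"
        by (intro integrable_abs Cc_bounded_integrable[OF h borel_reflect(1)[OF k(1)] bounded_comp[OF k(2)]])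
      show "integrable m (\<lambda>s. M * \<bar>h s\<bar>)"
        by (intro integrable_abs integrable_mult_right Cc_integrable h)
      show "\<bar>h s * k (- s + x)\<bar> \<le> M * \<bar>h s\<bar>" for s
        unfolding abs_mult by (subst mult.commute) (intro mult_right_mono M abs_ge_zero)
    qed
    finally show ?thesis .
  qed
  ultimately show ?thesis
    by (intro bcontfun_normI) (auto simp: continuous_on_eq_continuous_at)
qed

text \<open>Smoothing on the right by \<open>k\<close> makes right translation act continuously,
  even if \<open>h\<close> is only bounded and Borel. This is how elements of
  \<open>L_infty m\<close> are carried into \<open>Cb_lu\<close>.\<close>

lemma conv_Cb_lu:
  fixes h k :: "'a \<Rightarrow> real"
  assumes k: "k \<in> Cc" and h: "h \<in> borel_measurable borel" "bounded (range h)"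
  shows "conv h k \<in> fst Cb_lu"
proof -
  obtain M where M: "M > 0" "\<And>x. \<bar>h x\<bar> \<le> M" using h(2) unfolding bounded_pos by auto
  have "isCont (conv h k) x" for x
  proof -
    have "((\<lambda>g. conv h k (0 + g)) \<longlongrightarrow> conv h k (0 + x)) (nhds x)"
      by (rule tendsto_uniform_limitI[OF conv_right_uniform[OF assms]]) simp
    then have "((\<lambda>g. conv h k g) \<longlongrightarrow> conv h k x) (nhds x)" by simp
    then show ?thesis unfolding isCont_def
      by (rule tendsto_mono[rotated]) (simp add: at_within_def)
  qed
  moreover have "\<bar>conv h k x\<bar> \<le> (\<integral>s. M * \<bar>k (- s + 0)\<bar> \<partial>m)" for x
  proof -
    have "conv h k x = (\<integral>s. h (x + s) * k (- s + 0) \<partial>m)"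
      using conv_translate[OF h(1) Cc_borel[OF k], of x 0] by simp
    then have "\<bar>conv h k x\<bar> \<le> (\<integral>s. \<bar>h (x + s) * k (- s + 0)\<bar> \<partial>m)"
      by (simp only: integral_abs_bound)
    also have "\<dots> \<le> (\<integral>s. M * \<bar>k (- s + 0)\<bar> \<partial>m)"
    proof (rule integral_mono)
      show "integrable m (\<lambda>s. \<bar>h (x + s) * k (- s + 0)\<bar>)"
        by (subst mult.commute)
          (intro integrable_abs Cc_bounded_integrable[OF Cc_reflect[OF k] borel_reflect(2)[OF h(1)] bounded_comp[OF h(2)]])
      show "integrable m (\<lambda>s. M * \<bar>k (- s + 0)\<bar>)"
        by (intro integrable_abs integrable_mult_right Cc_integrable Cc_reflect k)
      show "\<bar>h (x + s) * k (- s + 0)\<bar> \<le> M * \<bar>k (- s + 0)\<bar>" for s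
        unfolding abs_mult by (intro mult_right_mono M abs_ge_zero)
    qed
    finally show ?thesis .
  qed
  ultimately have "conv h k \<in> bcontfun"
    by (intro bcontfun_normI) (auto simp: continuous_on_eq_continuous_at)
  then show ?thesis using conv_right_uniform[OF assms] by (simp add: Cb_lu_iff)
qed

lemma bcontfun_borel: "f \<in> bcontfun \<Longrightarrow> f \<in> borel_measurable borel"
  and bcontfun_bounded: "f \<in> bcontfun \<Longrightarrow> bounded (range f)"
  and bcontfun_continuous: "f \<in> bcontfun \<Longrightarrow> continuous_on UNIV f" for f :: "'a \<Rightarrow> real"
  unfolding bcontfun_def by (auto intro: borel_measurable_continuous_onI)

text \<open>Convolution from the left by \<open>h\<close> commutes with right translations and is
  bounded in supremum norm by the L1 norm of \<open>h\<close>, so it preserves \<open>Cb_lu\<close>.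
  Smoothing by \<open>h\<close> also gives continuity under left translations.\<close>

lemma conv_Cb_u:
  fixes h k :: "'a \<Rightarrow> real"
  assumes h: "h \<in> Cc" and k: "k \<in> fst Cb_lu"
  shows "conv h k \<in> fst Cb_u"
proof -
  have kb: "k \<in> bcontfun" and ku: "\<And>g. uniform_limit UNIV (\<lambda>g x. k (x + g)) (\<lambda>x. k (x + g)) (nhds g)"
    using k by (auto simp: Cb_lu_iff)
  note k' = bcontfun_borel[OF kb] bcontfun_bounded[OF kb]
  have cb: "conv h k \<in> bcontfun" by (rule conv_Cc_bcontfun[OF h k'])
  have int: "integrable m (\<lambda>s. h s * k (- s + x))" for x
    by (rule Cc_bounded_integrable[OF h borel_reflect(1)[OF k'(1)] bounded_comp[OF k'(2)]])
  have inth: "integrable m (\<lambda>s. \<bar>h s\<bar>)" by (intro integrable_abs Cc_integrable h)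
  define N where "N = (\<integral>s. \<bar>h s\<bar> \<partial>m)"
  have N: "N \<ge> 0" by (simp add: N_def)
  have "uniform_limit UNIV (\<lambda>g x. conv h k (x + g)) (\<lambda>x. conv h k (x + g0)) (nhds g0)" for g0
  proof (rule uniform_limitI)
    fix e :: real assume e: "e > 0"
    define d where "d = e / (N + 1)"
    have d: "d > 0" "d * N < e" using e N by (auto simp: d_def field_simps)
    show "\<forall>\<^sub>F g in nhds g0. \<forall>x\<in>UNIV. dist (conv h k (x + g)) (conv h k (x + g0)) < e"
      using uniform_limitD[OF ku d(1)]
    proof eventually_elim
      case (elim g)
      have "\<bar>conv h k (x + g) - conv h k (x + g0)\<bar> \<le> d * N" for x
      proof -
        have "conv h k (x + g) - conv h k (x + g0) = (\<integral>s. h s * k (- s + (x + g)) - h s * k (- s + (x + g0)) \<partial>m)"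
          unfolding conv_def Bochner_Integration.integral_diff[OF int int] ..
        then have "\<bar>conv h k (x + g) - conv h k (x + g0)\<bar> \<le> (\<integral>s. \<bar>h s * k (- s + (x + g)) - h s * k (- s + (x + g0))\<bar> \<partial>m)"
      by (simp only: integral_abs_bound)
        also have "\<dots> \<le> (\<integral>s. d * \<bar>h s\<bar> \<partial>m)"
        proof (rule integral_mono)
          show "\<bar>h s * k (- s + (x + g)) - h s * k (- s + (x + g0))\<bar> \<le> d * \<bar>h s\<bar>" for s
            unfolding right_diff_distrib[symmetric] abs_mult
            using elim[rule_format, of "- s + x"]
            by (subst mult.commute) (intro mult_right_mono, auto simp: dist_real_def add.assoc)
        qed (intro integrable_abs Bochner_Integration.integrable_diff int integrable_mult_right inth)+
        finally show ?thesis by (simp add: N_def)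
      qed
      then show ?case using d(2) by (auto simp: dist_real_def intro: le_less_trans)
    qed
  qed
  then show ?thesis
    using cb conv_left_uniform[OF h k'] unfolding Cb_u_def fst_conv Int_iff Cb_lu_iff Cb_ru_iff by blast
qed

lemma conv_support:
  fixes f \<phi> :: "'a \<Rightarrow> real"
  assumes "\<And>x. x \<notin> K \<Longrightarrow> f x = 0" "\<And>x. x \<notin> L \<Longrightarrow> \<phi> x = 0" "x \<notin> (\<lambda>(x, y). x + y) ` (K \<times> L)"
  shows "conv f \<phi> x = 0"
proof -
  have "f s * \<phi> (- s + x) = 0" for s
  proof (rule ccontr)
    assume "\<not> ?thesis"
    then have "s \<in> K" "- s + x \<in> L" using assms(1,2) by force+
    then have "(\<lambda>(x, y). x + y) (s, - s + x) \<in> (\<lambda>(x, y). x + y) ` (K \<times> L)"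
      by (intro imageI) auto
    then show False using assms(3) by (simp add: add.assoc[symmetric])
  qed
  then show ?thesis unfolding conv_def by (simp only: integral_zero)
qed

lemma conv_Cc:
  assumes "f \<in> Cc" "\<phi> \<in> Cc"
  shows "conv f \<phi> \<in> Cc"
proof -
  obtain K where K: "compact K" "\<And>x. x \<notin> K \<Longrightarrow> f x = 0" using CcE[OF assms(1)] by blast
  obtain L where L: "compact L" "\<And>x. x \<notin> L \<Longrightarrow> \<phi> x = 0" using CcE[OF assms(2)] by blast
  obtain B where "\<And>x. \<bar>\<phi> x\<bar> \<le> B" using Cc_bound[OF assms(2)] by blast
  then have \<phi>: "bounded (range \<phi>)" by (auto intro!: boundedI)
  show ?thesis
  proof (rule CcI)
    show "continuous_on UNIV (conv f \<phi>)"
      using conv_Cc_bcontfun[OF assms(1) Cc_borel[OF assms(2)] \<phi>]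
      by (rule bcontfun_continuous)
    show "compact ((\<lambda>(x, y). x + y) ` (K \<times> L))" by (rule compact_add[OF K(1) L(1)])
  qed (rule conv_support[OF K(2) L(2)])
qed

end

section \<open>Uniqueness of the Haar integral\<close>

text \<open>Continuity on the functions supported in a fixed compact set is all the uniqueness proof
  needs; positivity is not assumed because the functionals below come from signed integrands.\<close>

locale invariant_functional = haar_group +
  fixes l :: "('a \<Rightarrow> real) \<Rightarrow> real"
  assumes add: "\<phi> \<in> Cc \<Longrightarrow> \<psi> \<in> Cc \<Longrightarrow> l (\<lambda>x. \<phi> x + \<psi> x) = l \<phi> + l \<psi>"
    and scale: "\<phi> \<in> Cc \<Longrightarrow> l (\<lambda>x. c * \<phi> x) = c * l \<phi>"
    and inv: "\<phi> \<in> Cc \<Longrightarrow> l (left_translate g \<phi>) = l \<phi>"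
    and bnd: "compact K \<Longrightarrow>
      \<exists>C. \<forall>\<phi>\<in>Cc. (\<forall>x. \<bar>\<phi> x\<bar> \<le> 1) \<and> (\<forall>x. x \<notin> K \<longrightarrow> \<phi> x = 0) \<longrightarrow> \<bar>l \<phi>\<bar> \<le> C"
begin

text \<open>Rescaling by \<open>1 / e\<close> turns \<open>bnd\<close> into an estimate that is
  linear in the supremum bound; \<open>max C 0\<close> makes the constant non-negative.\<close>

lemma bound:
  assumes "compact K"
  obtains C where "C \<ge> 0"
    "\<And>\<phi> e. \<phi> \<in> Cc \<Longrightarrow> 0 < e \<Longrightarrow> (\<And>x. \<bar>\<phi> x\<bar> \<le> e) \<Longrightarrow> (\<And>x. x \<notin> K \<Longrightarrow> \<phi> x = 0) \<Longrightarrow> \<bar>l \<phi>\<bar> \<le> C * e"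
proof -
  obtain C where C: "\<And>\<phi>. \<phi> \<in> Cc \<Longrightarrow> (\<And>x. \<bar>\<phi> x\<bar> \<le> 1) \<Longrightarrow> (\<And>x. x \<notin> K \<Longrightarrow> \<phi> x = 0) \<Longrightarrow> \<bar>l \<phi>\<bar> \<le> C"
    using bnd[OF assms] by blast
  have "\<bar>l \<phi>\<bar> \<le> max C 0 * e"
    if "\<phi> \<in> Cc" "0 < e" "\<And>x. \<bar>\<phi> x\<bar> \<le> e" "\<And>x. x \<notin> K \<Longrightarrow> \<phi> x = 0" for \<phi> e
  proof -
    have "\<bar>l (\<lambda>x. (1 / e) * \<phi> x)\<bar> \<le> C"
      using that by (intro C Cc_cmult) (auto simp: abs_mult field_simps)
    then have "\<bar>l \<phi>\<bar> / e \<le> C" unfolding scale[OF that(1)] using that(2) by (simp add: abs_mult)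
    also have "C \<le> max C 0" by simp
    finally show ?thesis using that(2) by (simp add: field_simps)
  qed
  then show ?thesis using that[of "max C 0"] by simp
qed

lemma l_sum: "finite P \<Longrightarrow> (\<And>p. p \<in> P \<Longrightarrow> F p \<in> Cc) \<Longrightarrow> l (\<lambda>x. \<Sum>p\<in>P. F p x) = (\<Sum>p\<in>P. l (F p))"
proof (induction P rule: finite_induct)
  case empty
  show ?case using scale[OF Cc_zero, of 0] by simp
next
  case (insert p P)
  then show ?case using add[of "F p" "\<lambda>x. \<Sum>p\<in>P. F p x"] Cc_sum[of P F] by simp
qed

text \<open>Induction on \<open>P\<close> cuts \<open>B\<close> into pieces lying in translates of
  \<open>V\<close>. On the piece of \<open>p\<close>, replacing \<open>\<phi> (- s + x)\<close> by
  \<open>\<phi> (- p + x)\<close> costs at most \<open>d\<close>, and \<open>c p\<close> is the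
  integral of \<open>f\<close> over that piece. \<open>B\<close> is an arbitrary Borel set so that
  the induction can continue with what is left of it.\<close>

lemma conv_riemann_sum:
  assumes f: "f \<in> Cc" and \<phi>: "\<phi> \<in> Cc" and d: "0 < d" "\<And>v x. v \<in> V \<Longrightarrow> \<bar>\<phi> (- v + x) - \<phi> x\<bar> \<le> d"
    and V: "open V" and P: "finite P"
    and B: "B \<in> sets borel" "B \<subseteq> (\<Union>p\<in>P. (+) p ` V)"
  shows "\<exists>c. (\<forall>x. \<bar>(\<integral>s. indicator B s * (f s * \<phi> (- s + x)) \<partial>m) - (\<Sum>p\<in>P. c p * \<phi> (- p + x))\<bar>
      \<le> d * (\<integral>s. indicator B s * \<bar>f s\<bar> \<partial>m)) \<and> (\<Sum>p\<in>P. c p) = (\<integral>s. indicator B s * f s \<partial>m)"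
  using P B
proof (induction P arbitrary: B rule: finite_induct)
  case empty
  then show ?case by simp
next
  case (insert p P)
  have [measurable]: "f \<in> borel_measurable borel" "\<phi> \<in> borel_measurable borel"
    using f \<phi> Cc_borel by auto
  have fin: "integrable m (\<lambda>s. indicator A s * F s)" if "integrable m F" "A \<in> sets borel" for A and F :: "'a \<Rightarrow> real"
    using integrable_mult_indicator[of A m F] that by (simp add: sets_m)
  obtain M where M: "\<And>x. \<bar>\<phi> x\<bar> \<le> M" using Cc_bound[OF \<phi>] by blast
  have \<phi>b: "bounded (range \<phi>)" using M by (auto intro!: boundedI)
  have i0: "integrable m (\<lambda>s. f s * \<phi> (- s + x))" for x
    by (rule Cc_bounded_integrable[OF f borel_reflect(1)[OF Cc_borel[OF \<phi>]] bounded_comp[OF \<phi>b]])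
  have if0: "integrable m f" by (rule Cc_integrable[OF f])
  let ?pV = "(+) p ` V"
  define B1 where "B1 = B \<inter> ?pV"
  define B2 where "B2 = B - ?pV"
  have pV: "?pV \<in> sets borel" using open_translate[OF V] by simp
  have B12: "B1 \<in> sets borel" "B2 \<in> sets borel" using insert.prems(1) pV by (auto simp: B1_def B2_def)
  have ind: "indicator B s = indicator B1 s + (indicator B2 s :: real)" for s
    by (auto simp: B1_def B2_def indicator_def)
  have "B2 \<subseteq> (\<Union>p\<in>P. (+) p ` V)" using insert.prems(2) by (auto simp: B2_def)
  from insert.IH[OF B12(2) this] obtain c where
    c: "\<And>x. \<bar>(\<integral>s. indicator B2 s * (f s * \<phi> (- s + x)) \<partial>m) - (\<Sum>p\<in>P. c p * \<phi> (- p + x))\<bar>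
      \<le> d * (\<integral>s. indicator B2 s * \<bar>f s\<bar> \<partial>m)"
    "(\<Sum>p\<in>P. c p) = (\<integral>s. indicator B2 s * f s \<partial>m)" by blast
  define c1 where "c1 = (\<integral>s. indicator B1 s * f s \<partial>m)"
  have split: "(\<integral>s. indicator B s * F s \<partial>m) = (\<integral>s. indicator B1 s * F s \<partial>m) + (\<integral>s. indicator B2 s * F s \<partial>m)"
    if "integrable m F" for F :: "'a \<Rightarrow> real"
    unfolding ind distrib_right by (intro Bochner_Integration.integral_add fin that B12)
  have est: "\<bar>(\<integral>s. indicator B1 s * (f s * \<phi> (- s + x)) \<partial>m) - c1 * \<phi> (- p + x)\<bar>
      \<le> d * (\<integral>s. indicator B1 s * \<bar>f s\<bar> \<partial>m)" for x
  proof -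
    have "(\<integral>s. indicator B1 s * (f s * \<phi> (- s + x)) \<partial>m) - c1 * \<phi> (- p + x)
      = (\<integral>s. indicator B1 s * (f s * \<phi> (- s + x)) - indicator B1 s * f s * \<phi> (- p + x) \<partial>m)"
      unfolding c1_def
      by (subst Bochner_Integration.integral_diff) (auto intro!: fin i0 if0 B12 integrable_mult_left)
    then have "\<bar>(\<integral>s. indicator B1 s * (f s * \<phi> (- s + x)) \<partial>m) - c1 * \<phi> (- p + x)\<bar> \<le> (\<integral>s. \<bar>indicator B1 s * (f s * \<phi> (- s + x)) - indicator B1 s * f s * \<phi> (- p + x)\<bar> \<partial>m)"
      by (simp only: integral_abs_bound)
    also have "\<dots> \<le> (\<integral>s. d * (indicator B1 s * \<bar>f s\<bar>) \<partial>m)"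
    proof (rule integral_mono)
      show "integrable m (\<lambda>s. \<bar>indicator B1 s * (f s * \<phi> (- s + x)) - indicator B1 s * f s * \<phi> (- p + x)\<bar>)"
        by (intro integrable_abs Bochner_Integration.integrable_diff fin i0 if0 B12 integrable_mult_left)
      show "integrable m (\<lambda>s. d * (indicator B1 s * \<bar>f s\<bar>))"
        by (intro integrable_abs fin if0 B12 integrable_mult_right)
      show "\<bar>indicator B1 s * (f s * \<phi> (- s + x)) - indicator B1 s * f s * \<phi> (- p + x)\<bar>
        \<le> d * (indicator B1 s * \<bar>f s\<bar>)" for s
      proof (cases "s \<in> B1")
        case True
        then obtain v where v: "v \<in> V" "s = p + v" by (auto simp: B1_def)
        \<comment> \<open>Since \<open>s = p + v\<close>, the point \<open>- s + x\<close> equals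
          \<open>- v + (- p + x)\<close>; the hypothesis on \<open>V\<close> is used at
          \<open>- p + x\<close>.\<close>
        have "\<bar>\<phi> (- s + x) - \<phi> (- p + x)\<bar> \<le> d"
          using d(2)[OF v(1), of "- p + x"] unfolding v(2) minus_add add.assoc .
        then have "\<bar>f s\<bar> * \<bar>\<phi> (- s + x) - \<phi> (- p + x)\<bar> \<le> \<bar>f s\<bar> * d" by (rule mult_left_mono) simp
        then show ?thesis using True by (simp add: right_diff_distrib[symmetric] abs_mult mult.commute)
      qed simp
    qed
    finally show ?thesis by simp
  qed
  show ?case
  proof (intro exI conjI allI)
    let ?c = "c(p := c1)"
    have sumc: "(\<Sum>q\<in>insert p P. ?c q * \<phi> (- q + x)) = c1 * \<phi> (- p + x) + (\<Sum>q\<in>P. c q * \<phi> (- q + x))" for x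
      using insert.hyps by (auto intro!: sum.cong)
    show "\<bar>(\<integral>s. indicator B s * (f s * \<phi> (- s + x)) \<partial>m) - (\<Sum>q\<in>insert p P. ?c q * \<phi> (- q + x))\<bar>
      \<le> d * (\<integral>s. indicator B s * \<bar>f s\<bar> \<partial>m)" for x
      unfolding sumc split[OF i0] split[OF integrable_abs[OF if0]] distrib_left
      using est[of x] c(1)[of x] by linarith
    have "(\<Sum>q\<in>insert p P. ?c q) = c1 + (\<Sum>q\<in>P. c q)"
      using insert.hyps by (auto intro!: sum.cong)
    then show "(\<Sum>q\<in>insert p P. ?c q) = (\<integral>s. indicator B s * f s \<partial>m)"
      unfolding split[OF if0] c(2) c1_def by simp
  qed
qed

text \<open>\<open>conv f \<phi>\<close> is an average of left translates of \<phi> with weight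
  \<open>f\<close>, and \<open>l\<close> has the same value on all of them. Riemann sums replace an
  exchange of \<open>l\<close> with the integral: they approximate uniformly and vanish off the
  compact set \<open>L\<close>, where \<open>bound\<close> applies.\<close>

lemma l_conv:
  assumes f: "f \<in> Cc" and \<phi>: "\<phi> \<in> Cc"
  shows "l (conv f \<phi>) = (\<integral>s. f s \<partial>m) * l \<phi>"
proof -
  obtain K where K: "compact K" "\<And>x. x \<notin> K \<Longrightarrow> f x = 0" using CcE[OF f] by blast
  obtain K' where K': "compact K'" "\<And>x. x \<notin> K' \<Longrightarrow> \<phi> x = 0" using CcE[OF \<phi>] by blast
  define L where "L = (\<lambda>(x, y). x + y) ` (K \<times> K')"
  have L: "compact L" unfolding L_def by (rule compact_add[OF K(1) K'(1)])
  obtain C where C: "C \<ge> 0"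
    "\<And>\<phi> e. \<phi> \<in> Cc \<Longrightarrow> 0 < e \<Longrightarrow> (\<And>x. \<bar>\<phi> x\<bar> \<le> e) \<Longrightarrow> (\<And>x. x \<notin> L \<Longrightarrow> \<phi> x = 0) \<Longrightarrow> \<bar>l \<phi>\<bar> \<le> C * e"
    using bound[OF L] by blast
  define N where "N = (\<integral>s. \<bar>f s\<bar> \<partial>m)"
  have N: "N \<ge> 0" by (simp add: N_def)
  have "\<bar>l (conv f \<phi>) - (\<integral>s. f s \<partial>m) * l \<phi>\<bar> \<le> d * (C * (N + 1))" if d: "d > 0" for d
  proof -
    have "\<forall>\<^sub>F v in nhds 0. \<forall>x\<in>UNIV. dist (\<phi> (- v + x)) (\<phi> (- 0 + x)) < d"
      by (rule uniform_limit_translate[OF \<phi>, of 0]) (erule uniform_limitD[OF _ d])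
    then obtain V where V: "open V" "0 \<in> V" "\<And>v x. v \<in> V \<Longrightarrow> \<bar>\<phi> (- v + x) - \<phi> x\<bar> \<le> d"
      unfolding eventually_nhds by (auto simp: dist_real_def less_imp_le)
    obtain P where P: "finite P" "P \<subseteq> K" "K \<subseteq> (\<Union>p\<in>P. (+) p ` V)"
      using compact_cover_translates[OF K(1) V(1,2)] by metis
    have indK: "indicator K s * (f s * t) = f s * t" "indicator K s * f s = f s"
      "indicator K s * \<bar>f s\<bar> = \<bar>f s\<bar>" for s t
      using K(2)[of s] by (auto simp: indicator_def)
    obtain c where c: "\<And>x. \<bar>conv f \<phi> x - (\<Sum>p\<in>P. c p * \<phi> (- p + x))\<bar> \<le> d * N" "(\<Sum>p\<in>P. c p) = (\<integral>s. f s \<partial>m)"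
      using conv_riemann_sum[OF f \<phi> d V(3) V(1) P(1) borel_compact[OF K(1)] P(3)]
      unfolding indK conv_def N_def by blast
    define r where "r x = (\<Sum>p\<in>P. c p * left_translate p \<phi> x)" for x
    have r: "r \<in> Cc" unfolding r_def by (intro Cc_sum P(1) Cc_cmult Cc_left_translate \<phi>)
    have lr: "l r = (\<integral>s. f s \<partial>m) * l \<phi>"
      unfolding r_def
      by (subst l_sum) (auto simp: P(1) scale inv Cc_cmult Cc_left_translate \<phi> sum_distrib_right[symmetric] c(2))
    define u where "u x = conv f \<phi> x + (-1) * r x" for x
    have u: "u \<in> Cc" unfolding u_def by (intro Cc_add Cc_cmult conv_Cc f \<phi> r)
    have "l u = l (conv f \<phi>) + (- 1) * l r"
      unfolding u_def using add[OF conv_Cc[OF f \<phi>] Cc_cmult[OF r, of "-1"]] scale[OF r, of "-1"] by simp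
    moreover have "\<bar>l u\<bar> \<le> C * (d * (N + 1))"
    proof (rule C(2)[OF u])
      \<comment> \<open>The approximation error is \<open>d * N\<close>, which may be 0, whereas
        \<open>bound\<close> asks for a positive number.\<close>
      show "0 < d * (N + 1)" using d N by simp
      have "d * N \<le> d * (N + 1)" using d by simp
      then show "\<bar>u x\<bar> \<le> d * (N + 1)" for x
        using c(1)[of x] unfolding u_def r_def left_translate_def by linarith
      show "u x = 0" if "x \<notin> L" for x
      proof -
        have "- p + x \<notin> K'" if "p \<in> P" for p
        proof
          assume "- p + x \<in> K'"
          then have "(\<lambda>(x, y). x + y) (p, - p + x) \<in> L" unfolding L_def
            using P(2) that by (intro imageI) auto
          then show False using \<open>x \<notin> L\<close> by (simp add: add.assoc[symmetric])
        qed
        then have "r x = 0" unfolding r_def left_translate_def using K'(2) by simp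
        then show ?thesis unfolding u_def using conv_support[OF K(2) K'(2) that[unfolded L_def]] by simp
      qed
    qed
    ultimately show ?thesis using lr by (simp add: mult.assoc mult.left_commute)
  qed
  note bd = this
  define a where "a = \<bar>l (conv f \<phi>) - (\<integral>s. f s \<partial>m) * l \<phi>\<bar>"
  define b where "b = C * (N + 1)"
  have b: "b \<ge> 0" using C(1) N by (simp add: b_def)
  \<comment> \<open>The estimate is used with \<open>d = e / (b + 1)\<close>; adding 1 avoids a
    division by zero.\<close>
  have "a \<le> 0 + e" if "e > 0" for e
  proof -
    have "a \<le> e / (b + 1) * b" unfolding a_def b_def using bd[of "e / (b + 1)"] that b by (simp add: b_def)
    also have "\<dots> \<le> e" using that b by (simp add: field_simps)
    finally show ?thesis by simp
  qed
  then have "a \<le> 0" by (rule field_le_epsilon)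
  then show ?thesis by (simp add: a_def)
qed

text \<open>If \<phi> is concentrated near the identity, \<open>conv f \<phi>\<close> is uniformly
  close to \<open>f\<close> times the integral of \<open>\<phi> (- s)\<close>, with supports in a
  fixed compact set, and \<open>l_conv\<close> evaluates \<open>l\<close> on it. \<open>C\<close> is
  chosen before \<open>e\<close>, so that \<open>e\<close> can tend to 0 in
  \<open>unique\<close>.\<close>

lemma l_conv_approx:
  assumes f: "f \<in> Cc"
  obtains C where "C \<ge> 0"
    "\<And>e. e > 0 \<Longrightarrow> \<exists>U. open U \<and> 0 \<in> U \<and> (\<forall>\<phi>\<in>Cc. (\<forall>x. 0 \<le> \<phi> x) \<and> 0 < \<phi> 0 \<and> (\<forall>x. x \<notin> U \<longrightarrow> \<phi> x = 0) \<longrightarrow>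
       \<bar>(\<integral>s. f s \<partial>m) * l \<phi> - (\<integral>s. \<phi> (- s) \<partial>m) * l f\<bar> \<le> C * e * (\<integral>s. \<phi> (- s) \<partial>m))"
proof -
  obtain K where K: "compact K" "\<And>x. x \<notin> K \<Longrightarrow> f x = 0" using CcE[OF f] by blast
  obtain U0 K' :: "'a set" where U0: "open U0" "compact K'" "{0} \<subseteq> U0" "U0 \<subseteq> K'"
    using compact_neighbourhood[of "{0}"] by auto
  define L where "L = (\<lambda>(x, y). x + y) ` (K \<times> K')"
  have L: "compact L" unfolding L_def by (rule compact_add[OF K(1) U0(2)])
  obtain C where C: "C \<ge> 0"
    "\<And>\<phi> e. \<phi> \<in> Cc \<Longrightarrow> 0 < e \<Longrightarrow> (\<And>x. \<bar>\<phi> x\<bar> \<le> e) \<Longrightarrow> (\<And>x. x \<notin> L \<Longrightarrow> \<phi> x = 0) \<Longrightarrow> \<bar>l \<phi>\<bar> \<le> C * e"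
    using bound[OF L] by blast
  show ?thesis
  proof (rule that[OF C(1)])
    fix e :: real assume e: "e > 0"
    \<comment> \<open>As \<open>f (x + v) = f' (- v + - x)\<close>, left translates of the
      reflection control right translates of \<open>f\<close>.\<close>
    define f' where "f' s = f (- s)" for s
    have f': "f' \<in> Cc" unfolding f'_def by (rule Cc_translate(3)[OF f])
    have "\<forall>\<^sub>F v in nhds 0. \<forall>x\<in>UNIV. dist (f' (- v + x)) (f' (- 0 + x)) < e"
      by (rule uniform_limit_translate[OF f', of 0]) (erule uniform_limitD[OF _ e])
    then obtain V where V: "open V" "0 \<in> V" "\<And>v x. v \<in> V \<Longrightarrow> \<bar>f' (- v + x) - f' x\<bar> \<le> e"
      unfolding eventually_nhds by (auto simp: dist_real_def less_imp_le)
    have Vf: "\<bar>f (x + v) - f x\<bar> \<le> e" if "v \<in> V" for x v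
      using V(3)[OF that, of "- x"] by (simp add: f'_def minus_add)
    \<comment> \<open>\<open>U0\<close> keeps the support of \<phi> inside \<open>K'\<close>; the
      reflected set gives \<open>s \<in> V\<close> whenever \<open>- s \<in> U\<close>, as the
      integrand \<open>\<phi> (- s)\<close> requires.\<close>
    define U where "U = U0 \<inter> uminus -` V"
    have U: "open U" "0 \<in> U"
      using U0 V(1,2) open_vimage[OF V(1) continuous_on_translations(3)] by (auto simp: U_def)
    show "\<exists>U. open U \<and> 0 \<in> U \<and> (\<forall>\<phi>\<in>Cc. (\<forall>x. 0 \<le> \<phi> x) \<and> 0 < \<phi> 0 \<and> (\<forall>x. x \<notin> U \<longrightarrow> \<phi> x = 0) \<longrightarrow>
       \<bar>(\<integral>s. f s \<partial>m) * l \<phi> - (\<integral>s. \<phi> (- s) \<partial>m) * l f\<bar> \<le> C * e * (\<integral>s. \<phi> (- s) \<partial>m))"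
    proof (intro exI[of _ U] conjI U ballI impI)
      fix \<phi> :: "'a \<Rightarrow> real"
      assume \<phi>: "\<phi> \<in> Cc" and "(\<forall>x. 0 \<le> \<phi> x) \<and> 0 < \<phi> 0 \<and> (\<forall>x. x \<notin> U \<longrightarrow> \<phi> x = 0)"
      then have \<phi>': "\<And>x. 0 \<le> \<phi> x" "0 < \<phi> 0" "\<And>x. x \<notin> U \<Longrightarrow> \<phi> x = 0" by auto
      define N where "N = (\<integral>s. \<phi> (- s) \<partial>m)"
      have r\<phi>: "(\<lambda>s. \<phi> (- s)) \<in> Cc" by (rule Cc_translate(3)[OF \<phi>])
      have N: "N > 0" unfolding N_def
        using \<phi>' by (intro integral_pos[of _ 0] Cc_continuous Cc_integrable r\<phi>) auto
      define u where "u x = conv f \<phi> x + (- N) * f x" for x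
      have u: "u \<in> Cc" unfolding u_def by (intro Cc_add Cc_cmult conv_Cc f \<phi>)
      have lu: "l u = (\<integral>s. f s \<partial>m) * l \<phi> - N * l f"
        unfolding u_def
        using add[OF conv_Cc[OF f \<phi>] Cc_cmult[OF f, of "- N"]] scale[OF f, of "- N"] l_conv[OF f \<phi>] by simp
      have "\<bar>l u\<bar> \<le> C * (e * N)"
      proof (rule C(2)[OF u])
        show "0 < e * N" using e N by simp
        show "\<bar>u x\<bar> \<le> e * N" for x
        proof -
          obtain M where M: "\<And>x. \<bar>f x\<bar> \<le> M" using Cc_bound[OF f] by blast
          have fb: "bounded (range f)" using M by (auto intro!: boundedI)
          have i1: "integrable m (\<lambda>s. f (x + s) * \<phi> (- s))"
            using Cc_bounded_integrable[OF r\<phi> borel_reflect(2)[OF Cc_borel[OF f]] bounded_comp[OF fb]]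
            by (simp add: mult.commute)
          have i2: "integrable m (\<lambda>s. f x * \<phi> (- s))"
            by (intro integrable_mult_right Cc_integrable r\<phi>)
          have "u x = (\<integral>s. f (x + s) * \<phi> (- s) \<partial>m) - (\<integral>s. f x * \<phi> (- s) \<partial>m)"
            using conv_translate[OF Cc_borel[OF f] Cc_borel[OF \<phi>], of x 0] by (simp add: u_def N_def)
          also have "\<dots> = (\<integral>s. f (x + s) * \<phi> (- s) - f x * \<phi> (- s) \<partial>m)"
            using i1 i2 by simp
          finally have "u x = (\<integral>s. f (x + s) * \<phi> (- s) - f x * \<phi> (- s) \<partial>m)" .
          then have "\<bar>u x\<bar> \<le> (\<integral>s. \<bar>f (x + s) * \<phi> (- s) - f x * \<phi> (- s)\<bar> \<partial>m)"
            by (simp only: integral_abs_bound)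
          also have "\<dots> \<le> (\<integral>s. e * \<phi> (- s) \<partial>m)"
          proof (rule integral_mono)
            show "integrable m (\<lambda>s. \<bar>f (x + s) * \<phi> (- s) - f x * \<phi> (- s)\<bar>)"
              by (intro integrable_abs Bochner_Integration.integrable_diff i1 i2)
            show "integrable m (\<lambda>s. e * \<phi> (- s))" by (intro integrable_mult_right Cc_integrable r\<phi>)
            show "\<bar>f (x + s) * \<phi> (- s) - f x * \<phi> (- s)\<bar> \<le> e * \<phi> (- s)" for s
            proof (cases "- s \<in> U")
              case True
              then have "s \<in> V" by (simp add: U_def)
              then show ?thesis using Vf[of s x] \<phi>'(1)[of "- s"]
                by (auto simp: left_diff_distrib[symmetric] abs_mult intro!: mult_right_mono)
            qed (simp add: \<phi>'(3))
          qed
          finally show ?thesis by (simp add: N_def)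
        qed
        show "u x = 0" if "x \<notin> L" for x
        proof -
          have s\<phi>: "\<phi> x = 0" if "x \<notin> K'" for x using that U0(4) \<phi>'(3)[of x] by (auto simp: U_def)
          have "conv f \<phi> x = 0" by (rule conv_support[OF K(2) s\<phi> that[unfolded L_def]])
          \<comment> \<open>The identity lies in \<open>K'\<close>, so \<open>K\<close> is contained
            in \<open>L\<close>.\<close>
          moreover have "x \<notin> K"
          proof
            assume "x \<in> K"
            then have "(\<lambda>(x, y). x + y) (x, 0) \<in> L" unfolding L_def using U0(3,4) by (intro imageI) auto
            then show False using that by simp
          qed
          ultimately show ?thesis using K(2) by (simp add: u_def)
        qed
      qed
      then show "\<bar>(\<integral>s. f s \<partial>m) * l \<phi> - (\<integral>s. \<phi> (- s) \<partial>m) * l f\<bar> \<le> C * e * (\<integral>s. \<phi> (- s) \<partial>m)"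
        unfolding lu N_def by (simp add: mult.assoc)
    qed
  qed
qed

text \<open>A single \<phi> supported in both neighbourhoods compares \<open>l f\<close> with
  \<open>If\<close> and \<open>l g\<close> with \<open>Ig\<close>. Eliminating the common value
  \<open>l \<phi>\<close> and dividing by the positive number \<open>N\<close> leaves an error of
  \<open>b * e\<close>.\<close>

lemma unique:
  assumes f: "f \<in> Cc" and g: "g \<in> Cc"
  shows "l f * (\<integral>s. g s \<partial>m) = l g * (\<integral>s. f s \<partial>m)"
proof -
  define If where "If = (\<integral>s. f s \<partial>m)"
  define Ig where "Ig = (\<integral>s. g s \<partial>m)"
  obtain C where C: "C \<ge> 0" "\<And>e. e > 0 \<Longrightarrow> \<exists>U. open U \<and> 0 \<in> U \<and> (\<forall>\<phi>\<in>Cc. (\<forall>x. 0 \<le> \<phi> x) \<and> 0 < \<phi> 0 \<and> (\<forall>x. x \<notin> U \<longrightarrow> \<phi> x = 0) \<longrightarrow>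
       \<bar>If * l \<phi> - (\<integral>s. \<phi> (- s) \<partial>m) * l f\<bar> \<le> C * e * (\<integral>s. \<phi> (- s) \<partial>m))"
    using l_conv_approx[OF f] unfolding If_def by metis
  obtain D where D: "D \<ge> 0" "\<And>e. e > 0 \<Longrightarrow> \<exists>U. open U \<and> 0 \<in> U \<and> (\<forall>\<phi>\<in>Cc. (\<forall>x. 0 \<le> \<phi> x) \<and> 0 < \<phi> 0 \<and> (\<forall>x. x \<notin> U \<longrightarrow> \<phi> x = 0) \<longrightarrow>
       \<bar>Ig * l \<phi> - (\<integral>s. \<phi> (- s) \<partial>m) * l g\<bar> \<le> D * e * (\<integral>s. \<phi> (- s) \<partial>m))"
    using l_conv_approx[OF g] unfolding Ig_def by metis
  define b where "b = C * \<bar>Ig\<bar> + D * \<bar>If\<bar>"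
  have b: "b \<ge> 0" using C(1) D(1) by (simp add: b_def)
  have bd: "\<bar>l f * Ig - l g * If\<bar> \<le> b * e" if e: "e > 0" for e
  proof -
    obtain U1 where U1: "open U1" "0 \<in> U1" and 1: "\<And>\<phi>. \<phi> \<in> Cc \<Longrightarrow> (\<And>x. 0 \<le> \<phi> x) \<Longrightarrow> 0 < \<phi> 0 \<Longrightarrow> (\<And>x. x \<notin> U1 \<Longrightarrow> \<phi> x = 0)
        \<Longrightarrow> \<bar>If * l \<phi> - (\<integral>s. \<phi> (- s) \<partial>m) * l f\<bar> \<le> C * e * (\<integral>s. \<phi> (- s) \<partial>m)"
      using C(2)[OF e] by blast
    obtain U2 where U2: "open U2" "0 \<in> U2" and 2: "\<And>\<phi>. \<phi> \<in> Cc \<Longrightarrow> (\<And>x. 0 \<le> \<phi> x) \<Longrightarrow> 0 < \<phi> 0 \<Longrightarrow> (\<And>x. x \<notin> U2 \<Longrightarrow> \<phi> x = 0)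
        \<Longrightarrow> \<bar>Ig * l \<phi> - (\<integral>s. \<phi> (- s) \<partial>m) * l g\<bar> \<le> D * e * (\<integral>s. \<phi> (- s) \<partial>m)"
      using D(2)[OF e] by blast
    obtain \<phi> where \<phi>: "\<phi> \<in> Cc" "\<And>x. 0 \<le> \<phi> x" "\<phi> 0 = 1" "\<And>x. x \<notin> U1 \<inter> U2 \<Longrightarrow> \<phi> x = 0"
      using Urysohn_Cc[of "{0}" "U1 \<inter> U2"] U1 U2 by auto
    define N where "N = (\<integral>s. \<phi> (- s) \<partial>m)"
    have N: "N > 0" unfolding N_def
      using \<phi> by (intro integral_pos[of _ 0] Cc_continuous Cc_integrable Cc_translate) auto
    define p where "p = l \<phi>"
    have A: "\<bar>If * p - N * l f\<bar> \<le> C * e * N" unfolding N_def p_def by (rule 1) (use \<phi> in auto)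
    have B: "\<bar>Ig * p - N * l g\<bar> \<le> D * e * N" unfolding N_def p_def by (rule 2) (use \<phi> in auto)
    have "N * (l f * Ig - l g * If) = If * (Ig * p - N * l g) - Ig * (If * p - N * l f)"
      by (simp add: algebra_simps)
    then have "N * \<bar>l f * Ig - l g * If\<bar> = \<bar>If * (Ig * p - N * l g) - Ig * (If * p - N * l f)\<bar>"
      using N by (metis abs_mult abs_of_pos)
    also have "\<dots> \<le> \<bar>If\<bar> * \<bar>Ig * p - N * l g\<bar> + \<bar>Ig\<bar> * \<bar>If * p - N * l f\<bar>"
      unfolding abs_mult[symmetric] by (rule abs_triangle_ineq4)
    also have "\<dots> \<le> \<bar>If\<bar> * (D * e * N) + \<bar>Ig\<bar> * (C * e * N)"
      by (intro add_mono mult_left_mono A B) auto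
    also have "\<dots> = N * (b * e)" by (simp add: b_def algebra_simps)
    finally show ?thesis using N by simp
  qed
  define a where "a = \<bar>l f * Ig - l g * If\<bar>"
  have "a \<le> 0 + e" if "e > 0" for e
  proof -
    have "a \<le> b * (e / (b + 1))" unfolding a_def using bd[of "e / (b + 1)"] that b by simp
    also have "\<dots> \<le> e" using that b by (simp add: field_simps)
    finally show ?thesis by simp
  qed
  then have "a \<le> 0" by (rule field_le_epsilon)
  then show ?thesis by (simp add: a_def If_def Ig_def)
qed

end

section \<open>Transfer of invariant integrals\<close>

text \<open>An integral for \<open>E\<close> serves for \<open>F\<close> unchanged, as
  \<open>dominated F f\<close> lies in \<open>dominated E f\<close>. The third hypothesis ensures
  that a non-zero element of \<open>F\<close> stays non-zero in \<open>E\<close>.\<close>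

lemma property_mono:
  assumes "fst F \<subseteq> fst E" "snd E \<le> snd F"
    and "\<And>f. f \<in> fst F \<Longrightarrow> \<forall>\<^sub>F x in snd E. f x = 0 \<Longrightarrow> \<forall>\<^sub>F x in snd F. f x = 0"
    and "invariant_normalized_integral_property E"
  shows "invariant_normalized_integral_property F"
proof -
  have ev: "\<forall>\<^sub>F x in snd F. P x \<Longrightarrow> \<forall>\<^sub>F x in snd E. P x" for P
    using assms(2) by (simp add: le_filter_def)
  have dom: "dominated F f \<subseteq> dominated E f" for f
    unfolding dominated_def using assms(1) ev by blast
  have inh: "invariant_normalized_integral F f I" if "invariant_normalized_integral E f I" for f I
    using that dom[of f] ev unfolding invariant_normalized_integral_def by (intro conjI) blast+
  show ?thesis
    unfolding invariant_normalized_integral_property_def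
  proof (intro ballI impI)
    fix f assume "f \<in> fst F" "(\<forall>\<^sub>F x in snd F. 0 \<le> f x) \<and> \<not> (\<forall>\<^sub>F x in snd F. f x = 0)"
    then have "f \<in> fst E" "\<forall>\<^sub>F x in snd E. 0 \<le> f x" "\<not> (\<forall>\<^sub>F x in snd E. f x = 0)"
      using assms(1,3) ev by blast+
    then show "\<exists>I. invariant_normalized_integral F f I"
      using assms(4) inh unfolding invariant_normalized_integral_property_def by blast
  qed
qed

lemma invariant_normalized_integralD:
  assumes "invariant_normalized_integral E f I"
  shows "h \<in> dominated E f \<Longrightarrow> k \<in> dominated E f \<Longrightarrow> I (\<lambda>x. h x + k x) = I h + I k"
    and "h \<in> dominated E f \<Longrightarrow> I (\<lambda>x. c * h x) = c * I h"
    and "h \<in> dominated E f \<Longrightarrow> \<forall>\<^sub>F x in snd E. 0 \<le> h x \<Longrightarrow> 0 \<le> I h"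
    and "h \<in> dominated E f \<Longrightarrow> I (left_translate g h) = I h"
    and "I f = 1"
  using assms unfolding invariant_normalized_integral_def by blast+

lemma dominated_Cb_u_add:
  assumes "h \<in> dominated Cb_u f" "k \<in> dominated Cb_u f"
  shows "(\<lambda>x. h x + k x) \<in> dominated Cb_u f"
proof -
  obtain gs hs where gs: "\<And>x. \<bar>h x\<bar> \<le> (\<Sum>g\<leftarrow>gs. left_translate g f x)"
    and hs: "\<And>x. \<bar>k x\<bar> \<le> (\<Sum>g\<leftarrow>hs. left_translate g f x)"
    using assms unfolding dominated_def by (auto simp: Cb_u_def)
  have "\<bar>h x + k x\<bar> \<le> (\<Sum>g\<leftarrow>gs @ hs. left_translate g f x)" for x
    using gs[of x] hs[of x] by simp
  then have "\<exists>gs. \<forall>\<^sub>F x in snd Cb_u. \<bar>h x + k x\<bar> \<le> (\<Sum>g\<leftarrow>gs. left_translate g f x)"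
    by (intro exI[of _ "gs @ hs"] always_eventually) blast
  moreover have "(\<lambda>x. h x + k x) \<in> fst Cb_u"
    using assms Cb_u_add unfolding dominated_def by blast
  ultimately show ?thesis unfolding dominated_def by simp
qed

context haar_group
begin

section \<open>Right translations, modular constants and domination\<close>

text \<open>Right translation of the integrand gives another left invariant functional, which by
  uniqueness is a multiple of the Haar integral. Up to the convention about inverses,
  \<open>d\<close> is the value of the modular function at \<open>g\<close>.\<close>

lemma modular:
  fixes g :: 'a
  obtains d where "\<And>F. F \<in> Cc \<Longrightarrow> (\<integral>s. F (s + g) \<partial>m) = d * (\<integral>s. F s \<partial>m)"
proof -
  interpret R: invariant_functional m "\<lambda>\<phi>. \<integral>s. \<phi> (s + g) \<partial>m"
  proof unfold_locales
    show "(\<integral>s. \<phi> (s + g) + \<psi> (s + g) \<partial>m) = (\<integral>s. \<phi> (s + g) \<partial>m) + (\<integral>s. \<psi> (s + g) \<partial>m)"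
      if "\<phi> \<in> Cc" "\<psi> \<in> Cc" for \<phi> \<psi> :: "'a \<Rightarrow> real"
      by (intro Bochner_Integration.integral_add Cc_integrable Cc_translate that)
    show "(\<integral>s. c * \<phi> (s + g) \<partial>m) = c * (\<integral>s. \<phi> (s + g) \<partial>m)" for c and \<phi> :: "'a \<Rightarrow> real" by simp
    show "(\<integral>s. left_translate k \<phi> (s + g) \<partial>m) = (\<integral>s. \<phi> (s + g) \<partial>m)" if "\<phi> \<in> Cc" for k \<phi>
      using integral_translate[OF Cc_borel[OF Cc_translate(2)[OF that, of g]], of "- k"]
      by (simp add: left_translate_def add.assoc)
    show "\<exists>C. \<forall>\<phi>\<in>Cc. (\<forall>x. \<bar>\<phi> x\<bar> \<le> 1) \<and> (\<forall>x. x \<notin> K \<longrightarrow> \<phi> x = 0) \<longrightarrow> \<bar>\<integral>s. \<phi> (s + g) \<partial>m\<bar> \<le> C"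
      if K: "compact K" for K :: "'a set"
    proof (intro exI ballI impI)
      fix \<phi> :: "'a \<Rightarrow> real"
      \<comment> \<open>The translated integrand vanishes off this right translate of
        \<open>K\<close>, whose measure is the required bound.\<close>
      let ?K = "(\<lambda>x. x + - g) ` K"
      assume \<phi>: "\<phi> \<in> Cc" "(\<forall>x. \<bar>\<phi> x\<bar> \<le> 1) \<and> (\<forall>x. x \<notin> K \<longrightarrow> \<phi> x = 0)"
      have K': "compact ?K" by (rule compact_continuous_image[OF continuous_on_translations(2) K])
      have "\<bar>\<integral>s. \<phi> (s + g) \<partial>m\<bar> \<le> (\<integral>s. \<bar>\<phi> (s + g)\<bar> \<partial>m)" by (rule integral_abs_bound)
      also have "\<dots> \<le> 1 * measure m ?K"
      proof (rule compact_support_integrable(2)[OF Cc_borel[OF Cc_translate(2)[OF \<phi>(1)]] K'])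
        show "\<phi> (s + g) = 0" if "s \<notin> ?K" for s
        proof -
          have "s + g \<notin> K"
          proof
            assume "s + g \<in> K"
            then have "(s + g) + - g \<in> ?K" by (rule imageI)
            then show False using that by (simp add: add.assoc)
          qed
          then show ?thesis using \<phi>(2) by blast
        qed
      qed (use \<phi>(2) in blast)
      finally show "\<bar>\<integral>s. \<phi> (s + g) \<partial>m\<bar> \<le> 1 * measure m ?K" .
    qed
  qed
  obtain \<psi> :: "'a \<Rightarrow> real" where \<psi>: "\<psi> \<in> Cc" "\<And>x. 0 \<le> \<psi> x" "\<And>x. x \<in> {0} \<Longrightarrow> \<psi> x = 1"
    using Urysohn_Cc[of "{0}" UNIV] by auto
  have "0 < (\<integral>s. \<psi> s \<partial>m)"
    using \<psi> by (intro integral_pos[of _ 0] Cc_continuous Cc_integrable) auto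
  then show ?thesis
    using R.unique[OF _ \<psi>(1)] that[of "(\<integral>s. \<psi> (s + g) \<partial>m) / (\<integral>s. \<psi> s \<partial>m)"] by (simp add: field_simps)
qed

text \<open>Substituting \<open>s + g\<close> for \<open>s\<close> moves the translation from
  \<open>f\<close> to \<eta>. The same \<open>d\<close> occurs in both conclusions: \<open>d\<close>
  times the translated kernel has the same integral as \<eta>, from which
  \<open>property_Cb_lu\<close> gets invariance.\<close>

lemma conv_modular:
  fixes g :: 'a
  obtains d where "\<And>\<eta> f x. \<eta> \<in> Cc \<Longrightarrow> f \<in> bcontfun \<Longrightarrow>
      conv \<eta> (left_translate g f) x = d * conv (right_translate (- g) \<eta>) f x"
    "\<And>\<eta>. \<eta> \<in> Cc \<Longrightarrow> (\<integral>s. \<eta> s \<partial>m) = d * (\<integral>s. right_translate (- g) \<eta> s \<partial>m)"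
proof -
  obtain d where d: "\<And>F. F \<in> Cc \<Longrightarrow> (\<integral>s. F (s + g) \<partial>m) = d * (\<integral>s. F s \<partial>m)"
    using modular[of g] by blast
  have "conv \<eta> (left_translate g f) x = d * conv (right_translate (- g) \<eta>) f x"
    if \<eta>: "\<eta> \<in> Cc" and f: "f \<in> bcontfun" for \<eta> f x
  proof -
    let ?F = "\<lambda>s. \<eta> (s + - g) * f (- s + x)"
    have "?F \<in> Cc"
      by (intro Cc_mult_left Cc_translate(2) \<eta>
          continuous_on_UNIV_o[OF bcontfun_continuous[OF f] continuous_on_translations(4)])
    from d[OF this] show ?thesis
      unfolding conv_def left_translate_def right_translate_def minus_add add.assoc right_minus add_0_right .
  qed
  moreover have "(\<integral>s. \<eta> s \<partial>m) = d * (\<integral>s. right_translate (- g) \<eta> s \<partial>m)" if "\<eta> \<in> Cc" for \<eta>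
    using d[OF Cc_translate(2)[OF that, of "- g"]]
    unfolding right_translate_def add.assoc right_minus add_0_right .
  ultimately show ?thesis using that by blast
qed

lemma conv_integrable:
  assumes "\<eta> \<in> Cc" "f \<in> bcontfun"
  shows "integrable m (\<lambda>s. \<eta> s * f (- s + x))"
  by (rule Cc_bounded_integrable[OF assms(1) borel_reflect(1)[OF bcontfun_borel[OF assms(2)]]
      bounded_comp[OF bcontfun_bounded[OF assms(2)]]])

lemma left_translate_bcontfun: "f \<in> bcontfun \<Longrightarrow> left_translate g f \<in> bcontfun" for g :: 'a and f :: "'a \<Rightarrow> real"
  unfolding left_translate_def by (rule bcontfun_comp[OF _ continuous_on_translations(1)])

text \<open>By \<open>conv_modular\<close> each translate of \<open>f\<close> can be traded for a
  right translate of the kernel, and these add up to one kernel. Membership in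
  \<open>bcontfun\<close> is carried along to justify additivity.\<close>

lemma conv_sum_list_right:
  fixes f :: "'a \<Rightarrow> real"
  assumes \<eta>: "\<eta> \<in> Cc" and f: "f \<in> bcontfun"
  shows "(\<lambda>x. \<Sum>g\<leftarrow>gs. left_translate g f x) \<in> bcontfun \<and>
    (\<exists>\<eta>'\<in>Cc. \<forall>x. conv \<eta> (\<lambda>x. \<Sum>g\<leftarrow>gs. left_translate g f x) x = conv \<eta>' f x)"
proof (induction gs)
  case Nil
  have "conv \<eta> (\<lambda>x. 0) x = conv (\<lambda>x. 0) f x" for x by (simp add: conv_def)
  then show ?case using Cc_zero const_bcontfun[of 0] by auto
next
  case (Cons g gs)
  then obtain \<eta>' where \<eta>': "\<eta>' \<in> Cc" "\<And>x. conv \<eta> (\<lambda>x. \<Sum>g\<leftarrow>gs. left_translate g f x) x = conv \<eta>' f x"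
    by blast
  obtain d where d: "\<And>x. conv \<eta> (left_translate g f) x = d * conv (right_translate (- g) \<eta>) f x"
    using conv_modular[of g] \<eta> f by metis
  have t: "right_translate (- g) \<eta> \<in> Cc" unfolding right_translate_def by (rule Cc_translate(2)[OF \<eta>])
  have "conv \<eta> (\<lambda>x. left_translate g f x + (\<Sum>g\<leftarrow>gs. left_translate g f x)) x
      = conv (\<lambda>s. d * right_translate (- g) \<eta> s + \<eta>' s) f x" for x
    unfolding conv_add_right[OF conv_integrable[OF \<eta> left_translate_bcontfun[OF f]] conv_integrable[OF \<eta> conjunct1[OF Cons]]]
      conv_add_left[OF conv_integrable[OF Cc_cmult[OF t] f] conv_integrable[OF \<eta>'(1) f]]
      conv_cmult d \<eta>'(2) ..
  moreover have "(\<lambda>s. d * right_translate (- g) \<eta> s + \<eta>' s) \<in> Cc"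
    by (intro Cc_add Cc_cmult t \<eta>')
  moreover have "(\<lambda>x. left_translate g f x + (\<Sum>g\<leftarrow>gs. left_translate g f x)) \<in> bcontfun"
    using Cons by (intro plus_cont left_translate_bcontfun f) blast
  ultimately show ?case unfolding list.map sum_list.Cons by blast
qed

text \<open>Here the dominated function is the right factor, so its left translates are absorbed
  into the kernel \<open>\<eta>'\<close>. One majorant serves all \<open>e\<close> bounded by
  \<eta>; this uniformity yields the hypothesis \<open>bnd\<close> of the uniqueness result.\<close>

lemma conv_dominated_right:
  fixes f h :: "'a \<Rightarrow> real"
  assumes f: "f \<in> bcontfun" and h: "h \<in> bcontfun"
    and dom: "\<And>x. \<bar>h x\<bar> \<le> (\<Sum>g\<leftarrow>gs. left_translate g f x)" and \<eta>: "\<eta> \<in> Cc"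
  obtains \<eta>' where "\<eta>' \<in> Cc"
    "\<And>e x. e \<in> Cc \<Longrightarrow> (\<And>s. \<bar>e s\<bar> \<le> \<eta> s) \<Longrightarrow> \<bar>conv e h x\<bar> \<le> conv \<eta>' f x"
proof -
  let ?S = "\<lambda>x. \<Sum>g\<leftarrow>gs. left_translate g f x"
  have S: "?S \<in> bcontfun" using conv_sum_list_right[OF \<eta> f] by blast
  obtain \<eta>' where \<eta>': "\<eta>' \<in> Cc" "\<And>x. conv \<eta> ?S x = conv \<eta>' f x"
    using conv_sum_list_right[OF \<eta> f] by blast
  have "\<bar>conv e h x\<bar> \<le> conv \<eta>' f x" if e: "e \<in> Cc" "\<And>s. \<bar>e s\<bar> \<le> \<eta> s" for e x
  proof -
    have "\<bar>conv e h x\<bar> \<le> (\<integral>s. \<bar>e s * h (- s + x)\<bar> \<partial>m)" unfolding conv_def by (rule integral_abs_bound)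
    also have "\<dots> \<le> (\<integral>s. \<eta> s * ?S (- s + x) \<partial>m)"
    proof (rule integral_mono)
      show "integrable m (\<lambda>s. \<bar>e s * h (- s + x)\<bar>)" by (intro integrable_abs conv_integrable e h)
      show "integrable m (\<lambda>s. \<eta> s * ?S (- s + x))" by (rule conv_integrable[OF \<eta> S])
      show "\<bar>e s * h (- s + x)\<bar> \<le> \<eta> s * ?S (- s + x)" for s
        unfolding abs_mult using e(2)[of s] dom by (intro mult_mono) auto
    qed
    also have "\<dots> = conv \<eta>' f x" using \<eta>'(2)[of x] by (simp add: conv_def)
    finally show ?thesis .
  qed
  then show ?thesis using that \<eta>'(1) by blast
qed

section \<open>The implications between the five spaces\<close>

lemma property_L_infty:
  assumes "invariant_normalized_integral_property (Cb_lu :: 'a function_space)"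
  shows "invariant_normalized_integral_property (L_infty m)"
  unfolding invariant_normalized_integral_property_def
proof (intro ballI impI)
  fix f assume "f \<in> fst (L_infty m)"
    and *: "(\<forall>\<^sub>F x in snd (L_infty m). 0 \<le> f x) \<and> \<not> (\<forall>\<^sub>F x in snd (L_infty m). f x = 0)"
  then have f: "f \<in> borel_measurable borel" "bounded (range f)" by (auto simp: L_infty_def)
  have f0: "AE x in m. 0 \<le> f x" and fn: "\<not> (AE x in m. f x = 0)" using * by (auto simp: L_infty_def)
  let ?A = "{x. 0 < f x}"
  have A: "?A \<in> sets borel" using borel_measurable_less[OF borel_measurable_const f(1)] by simp
  have "emeasure m ?A \<noteq> 0"
  proof
    assume "emeasure m ?A = 0"
    then have "AE x in m. x \<notin> ?A" using A by (intro AE_not_in) (auto simp: null_sets_def sets_m)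
    then have "AE x in m. f x = 0" using f0 by eventually_elim auto
    then show False using fn by simp
  qed
  then obtain K where K: "compact K" "K \<subseteq> ?A" "emeasure m K \<noteq> 0"
    using exists_compact_subset[OF A] by blast
  obtain \<psi> where \<psi>: "\<psi> \<in> Cc" "\<And>x. 0 \<le> \<psi> x" "\<And>x. x \<in> K \<Longrightarrow> \<psi> x = 1"
    using Urysohn_Cc[OF K(1) open_UNIV subset_UNIV] by metis
  \<comment> \<open>The reflection makes \<open>conv f k 0\<close> the integral of
    \<open>f s * \<psi> s\<close>. It is non-zero because \<open>f\<close> is positive and \<psi> is
    1 on \<open>K\<close>, which is not null.\<close>
  define k where "k s = \<psi> (- s)" for s
  have k: "k \<in> Cc" "\<And>x. 0 \<le> k x" unfolding k_def using \<psi> Cc_translate(3) by auto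
  note kb = Cc_borel[OF k(1)]
  have int: "integrable m (\<lambda>s. h s * k (- s + x))"
    if "h \<in> borel_measurable borel" "bounded (range h)" for h x
    using Cc_bounded_integrable[OF Cc_reflect[OF k(1)] that] by (simp add: mult.commute)
  let ?f = "conv f k"
  have lu: "conv h k \<in> fst Cb_lu" if "h \<in> borel_measurable borel" "bounded (range h)" for h
    by (rule conv_Cb_lu[OF k(1) that])
  have nonneg: "0 \<le> conv h k x" if "AE s in m. 0 \<le> h s" for h x
    unfolding conv_def using that k(2) by (intro integral_nonneg_AE) (auto elim!: eventually_mono)
  have nz: "?f 0 \<noteq> 0"
  proof
    assume "?f 0 = 0"
    then have "(\<integral>s. f s * \<psi> s \<partial>m) = 0" by (simp add: conv_def k_def)
    moreover have "integrable m (\<lambda>s. f s * \<psi> s)"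
      using int[OF f, of 0] by (simp add: k_def)
    moreover have "AE s in m. 0 \<le> f s * \<psi> s" using f0 by eventually_elim (simp add: \<psi>(2))
    ultimately have "AE s in m. f s * \<psi> s = 0" by (simp add: integral_nonneg_eq_0_iff_AE)
    then have "AE s in m. s \<notin> K"
      by eventually_elim (use K(2) \<psi>(3) in force)
    then have "K \<in> null_sets m"
      using K(1) by (subst (asm) AE_iff_null) (auto simp: sets_m space_m borel_compact)
    then show False using K(3) by (simp add: null_sets_def)
  qed
  have "\<not> (\<forall>\<^sub>F x in snd Cb_lu. ?f x = 0)" using nz by (auto simp: Cb_lu_def)
  moreover have "\<forall>\<^sub>F x in snd Cb_lu. 0 \<le> ?f x" using nonneg[OF f0] by (auto simp: Cb_lu_def)
  ultimately obtain J where J: "invariant_normalized_integral Cb_lu ?f J"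
    using assms lu[OF f] unfolding invariant_normalized_integral_property_def by blast
  have domE: "h \<in> borel_measurable borel" "bounded (range h)" "conv h k \<in> dominated Cb_lu ?f"
    if dh: "h \<in> dominated (L_infty m) f" for h
  proof -
    show h: "h \<in> borel_measurable borel" "bounded (range h)"
      using dh by (auto simp: dominated_def L_infty_def)
    obtain gs where gs: "AE s in m. \<bar>h s\<bar> \<le> (\<Sum>g\<leftarrow>gs. left_translate g f s)"
      using dh by (auto simp: dominated_def L_infty_def)
    have "\<bar>conv h k x\<bar> \<le> (\<Sum>g\<leftarrow>gs. left_translate g ?f x)" for x
      by (rule conv_dominated[OF f(1) kb k(2) int[OF f] int[OF h] gs])
    then show "conv h k \<in> dominated Cb_lu ?f"
      using lu[OF h] unfolding dominated_def by (auto simp: Cb_lu_def)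
  qed
  show "\<exists>I. invariant_normalized_integral (L_infty m) f I"
  proof (intro exI[of _ "\<lambda>h. J (conv h k)"])
    show "invariant_normalized_integral (L_infty m) f (\<lambda>h. J (conv h k))"
      unfolding invariant_normalized_integral_def
    proof (intro conjI ballI allI impI)
      fix h h' assume h: "h \<in> dominated (L_infty m) f" and h': "h' \<in> dominated (L_infty m) f"
      \<comment> \<open>Convolution ignores null sets, so the functional respects almost-everywhere
        equality.\<close>
      show "J (conv h k) = J (conv h' k)" if "\<forall>\<^sub>F x in snd (L_infty m). h x = h' x"
        using conv_cong_AE[OF domE(1)[OF h] domE(1)[OF h'] kb] that by (simp add: L_infty_def)
      have "conv (\<lambda>x. h x + h' x) k = (\<lambda>x. conv h k x + conv h' k x)"
        by (intro ext conv_add_left int domE[OF h] domE[OF h'])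
      then show "J (conv (\<lambda>x. h x + h' x) k) = J (conv h k) + J (conv h' k)"
        using invariant_normalized_integralD(1)[OF J domE(3)[OF h] domE(3)[OF h']] by simp
    next
      fix c h assume h: "h \<in> dominated (L_infty m) f"
      have "conv (\<lambda>x. c * h x) k = (\<lambda>x. c * conv h k x)" by (intro ext conv_cmult)
      then show "J (conv (\<lambda>x. c * h x) k) = c * J (conv h k)"
        using invariant_normalized_integralD(2)[OF J domE(3)[OF h]] by simp
    next
      fix h assume h: "h \<in> dominated (L_infty m) f" and "\<forall>\<^sub>F x in snd (L_infty m). 0 \<le> h x"
      then have "\<forall>\<^sub>F x in snd Cb_lu. 0 \<le> conv h k x" using nonneg by (auto simp: L_infty_def)
      then show "0 \<le> J (conv h k)"
        by (rule invariant_normalized_integralD(3)[OF J domE(3)[OF h]])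
    next
      fix g h assume h: "h \<in> dominated (L_infty m) f"
      show "J (conv (left_translate g h) k) = J (conv h k)"
        unfolding conv_left_translate[OF domE(1)[OF h] kb]
        by (rule invariant_normalized_integralD(4)[OF J domE(3)[OF h]])
    next
      show "J ?f = 1" by (rule invariant_normalized_integralD(5)[OF J])
    qed
  qed
qed

lemma property_Cb_lu:
  assumes "invariant_normalized_integral_property (Cb_u :: 'a function_space)"
  shows "invariant_normalized_integral_property (Cb_lu :: 'a function_space)"
  unfolding invariant_normalized_integral_property_def
proof (intro ballI impI)
  fix f :: "'a \<Rightarrow> real"
  assume flu: "f \<in> fst Cb_lu" and *: "(\<forall>\<^sub>F x in snd Cb_lu. 0 \<le> f x) \<and> \<not> (\<forall>\<^sub>F x in snd Cb_lu. f x = 0)"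
  have f: "f \<in> bcontfun" using flu by (simp add: Cb_lu_iff)
  have f0: "\<And>x. 0 \<le> f x" using * by (simp add: Cb_lu_def)
  obtain x0 where "f x0 \<noteq> 0" using * by (auto simp: Cb_lu_def)
  then have x0: "0 < f x0" using f0[of x0] by simp
  \<comment> \<open>The value at the identity serves twice: it makes \<open>conv \<phi> f\<close>
    positive at \<open>x0\<close>, and it lets sums of translates of \<phi> dominate every function
    in \<open>Cc\<close>.\<close>
  obtain \<phi> :: "'a \<Rightarrow> real" where \<phi>: "\<phi> \<in> Cc" "\<And>x. 0 \<le> \<phi> x" "\<phi> 0 = 1"
    using Urysohn_Cc[of "{0}" UNIV] by auto
  have I\<phi>: "0 < (\<integral>s. \<phi> s \<partial>m)"
    using \<phi> by (intro integral_pos[of _ 0] Cc_continuous Cc_integrable) auto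
  let ?f = "conv \<phi> f"
  have fu: "?f \<in> fst Cb_u" by (rule conv_Cb_u[OF \<phi>(1) flu])
  have nonneg: "0 \<le> conv \<phi> h x" if "\<And>x. 0 \<le> h x" for h x
    unfolding conv_def using that \<phi>(2) by (intro integral_nonneg_AE) auto
  have "0 < ?f x0"
    unfolding conv_def
  proof (rule integral_pos)
    show "continuous_on UNIV (\<lambda>s. \<phi> s * f (- s + x0))"
      by (intro continuous_on_mult Cc_continuous \<phi>
          continuous_on_UNIV_o[OF bcontfun_continuous[OF f] continuous_on_translations(4)])
    show "integrable m (\<lambda>s. \<phi> s * f (- s + x0))" by (rule conv_integrable[OF \<phi>(1) f])
    show "0 < \<phi> 0 * f (- 0 + x0)" using \<phi>(3) x0 by simp
  qed (use \<phi>(2) f0 in auto)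
  then have "\<not> (\<forall>\<^sub>F x in snd Cb_u. ?f x = 0)" by (auto simp: Cb_u_def intro!: exI[of _ x0])
  moreover have "\<forall>\<^sub>F x in snd Cb_u. 0 \<le> ?f x" using nonneg[OF f0] by (auto simp: Cb_u_def)
  ultimately obtain J where "invariant_normalized_integral Cb_u ?f J"
    using assms fu unfolding invariant_normalized_integral_property_def by blast
  then have J_add: "\<And>h k. h \<in> dominated Cb_u ?f \<Longrightarrow> k \<in> dominated Cb_u ?f \<Longrightarrow> J (\<lambda>x. h x + k x) = J h + J k"
    and J_scale: "\<And>c h. h \<in> dominated Cb_u ?f \<Longrightarrow> J (\<lambda>x. c * h x) = c * J h"
    and J_pos: "\<And>h. h \<in> dominated Cb_u ?f \<Longrightarrow> (\<And>x. 0 \<le> h x) \<Longrightarrow> 0 \<le> J h"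
    and J_inv: "\<And>g h. h \<in> dominated Cb_u ?f \<Longrightarrow> J (left_translate g h) = J h"
    and J_f: "J ?f = 1"
    using invariant_normalized_integralD[of Cb_u ?f J] by (blast intro: always_eventually)+
  \<comment> \<open>A sum of translates of \<phi> dominates \<eta>. Translations of the left factor
    pass outside, which gives domination by translates of \<open>?f\<close>.\<close>
  have base: "conv \<eta> f \<in> dominated Cb_u ?f" if \<eta>: "\<eta> \<in> Cc" for \<eta>
  proof -
    obtain gs where gs: "\<And>x. \<bar>\<eta> x\<bar> \<le> (\<Sum>g\<leftarrow>gs. left_translate g \<phi> x)"
      using translate_domination[OF \<phi>(1,2) _ \<eta>] \<phi>(3) by (metis zero_less_one)
    have "\<bar>conv \<eta> f x\<bar> \<le> (\<Sum>g\<leftarrow>gs. left_translate g ?f x)" for x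
      using gs by (intro conv_dominated Cc_borel bcontfun_borel conv_integrable \<phi> f \<eta> f0) simp
    then show ?thesis using conv_Cb_u[OF \<eta> flu] unfolding dominated_def by (auto simp: Cb_u_def)
  qed
  have dom_lu: "h \<in> fst Cb_lu" if "h \<in> dominated Cb_lu f" for h
    using that unfolding dominated_def by blast
  have dom_b: "h \<in> bcontfun" if "h \<in> dominated Cb_lu f" for h
    using dom_lu[OF that] by (simp add: Cb_lu_iff)
  have dom_right: "\<exists>\<eta>'\<in>Cc. \<forall>e\<in>Cc. (\<forall>s. \<bar>e s\<bar> \<le> \<eta> s) \<longrightarrow> (\<forall>x. \<bar>conv e h x\<bar> \<le> conv \<eta>' f x)"
    if h: "h \<in> dominated Cb_lu f" and \<eta>: "\<eta> \<in> Cc" for h \<eta>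
  proof -
    obtain gs where gs: "\<And>x. \<bar>h x\<bar> \<le> (\<Sum>g\<leftarrow>gs. left_translate g f x)"
      using h by (auto simp: dominated_def Cb_lu_def)
    show ?thesis by (rule conv_dominated_right[OF f dom_b[OF h] gs \<eta>]) blast
  qed
  \<comment> \<open>Two dominations are chained: \<open>dom_right\<close> leads to a convolution
    with \<open>f\<close>, and \<open>base\<close> leads from there to translates of
    \<open>?f\<close>.\<close>
  have mem: "conv e h \<in> dominated Cb_u ?f" if h: "h \<in> dominated Cb_lu f" and e: "e \<in> Cc" for e h
  proof -
    obtain \<eta> where \<eta>: "\<eta> \<in> Cc" "\<And>x. \<bar>conv e h x\<bar> \<le> conv \<eta> f x"
      using dom_right[OF h Cc_abs[OF e]] e by blast
    obtain gs where "\<And>x. \<bar>conv \<eta> f x\<bar> \<le> (\<Sum>g\<leftarrow>gs. left_translate g ?f x)"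
      using base[OF \<eta>(1)] by (auto simp: dominated_def Cb_u_def)
    then have "\<bar>conv e h x\<bar> \<le> (\<Sum>g\<leftarrow>gs. left_translate g ?f x)" for x
      using \<eta>(2)[of x] abs_ge_self order_trans by metis
    then show ?thesis using conv_Cb_u[OF e dom_lu[OF h]] unfolding dominated_def by (auto simp: Cb_u_def)
  qed
  have conv_add: "conv (\<lambda>s. e s + e' s) h = (\<lambda>x. conv e h x + conv e' h x)"
    if "e \<in> Cc" "e' \<in> Cc" "h \<in> dominated Cb_lu f" for e e' h
    by (intro ext conv_add_left conv_integrable that dom_b)
  \<comment> \<open>For fixed \<open>h\<close>, left translation of \<open>e\<close> is left
    translation of \<open>conv e h\<close>, so invariance comes from \<open>J\<close>. The bound on
    a compact set comes from positivity of \<open>J\<close>.\<close>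
  have radon: "invariant_functional m (\<lambda>e. J (conv e h))" if h: "h \<in> dominated Cb_lu f" for h
  proof unfold_locales
    show "J (conv (\<lambda>s. e s + e' s) h) = J (conv e h) + J (conv e' h)" if "e \<in> Cc" "e' \<in> Cc" for e e'
      unfolding conv_add[OF that h] by (intro J_add mem h that)
    show sc: "J (conv (\<lambda>s. c * e s) h) = c * J (conv e h)" if "e \<in> Cc" for c e
      unfolding conv_cmult by (intro J_scale mem h that)
    show "J (conv (left_translate g e) h) = J (conv e h)" if "e \<in> Cc" for g e
      unfolding conv_left_translate[OF Cc_borel[OF that] bcontfun_borel[OF dom_b[OF h]]]
      by (intro J_inv mem h that)
    fix K :: "'a set" assume K: "compact K"
    obtain \<eta> where \<eta>: "\<eta> \<in> Cc" "\<And>x. 0 \<le> \<eta> x" "\<And>x. x \<in> K \<Longrightarrow> \<eta> x = 1"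
      using Urysohn_Cc[OF K open_UNIV subset_UNIV] by metis
    obtain \<eta>' where \<eta>': "\<eta>' \<in> Cc" "\<And>e x. e \<in> Cc \<Longrightarrow> (\<And>s. \<bar>e s\<bar> \<le> \<eta> s) \<Longrightarrow> \<bar>conv e h x\<bar> \<le> conv \<eta>' f x"
      using dom_right[OF h \<eta>(1)] by blast
    let ?S = "conv \<eta>' f"
    \<comment> \<open>Used for both \<open>e\<close> and its negative, this bounds the absolute
      value of \<open>J (conv e h)\<close> by \<open>J ?S\<close>, which does not depend on
      \<open>e\<close>.\<close>
    have lower: "0 \<le> J ?S + J (conv e h)" if e: "e \<in> Cc" "\<And>s. \<bar>e s\<bar> \<le> \<eta> s" for e
    proof -
      have "0 \<le> J (\<lambda>x. ?S x + conv e h x)"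
      proof (rule J_pos)
        show "(\<lambda>x. ?S x + conv e h x) \<in> dominated Cb_u ?f"
          by (intro dominated_Cb_u_add base \<eta>' mem h e)
        show "0 \<le> ?S x + conv e h x" for x using \<eta>'(2)[OF e, of x] by linarith
      qed
      then show ?thesis unfolding J_add[OF base[OF \<eta>'(1)] mem[OF h e(1)]] .
    qed
    show "\<exists>C. \<forall>e\<in>Cc. (\<forall>x. \<bar>e x\<bar> \<le> 1) \<and> (\<forall>x. x \<notin> K \<longrightarrow> e x = 0) \<longrightarrow> \<bar>J (conv e h)\<bar> \<le> C"
    proof (intro exI[of _ "J ?S"] ballI impI)
      fix e :: "'a \<Rightarrow> real" assume e: "e \<in> Cc" "(\<forall>x. \<bar>e x\<bar> \<le> 1) \<and> (\<forall>x. x \<notin> K \<longrightarrow> e x = 0)"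
      have b: "\<bar>e s\<bar> \<le> \<eta> s" for s using e(2) \<eta>(2,3) by (cases "s \<in> K") auto
      have "0 \<le> J ?S + J (conv e h)" by (rule lower[OF e(1) b])
      moreover have "0 \<le> J ?S + J (conv (\<lambda>s. (-1) * e s) h)"
        by (rule lower[OF Cc_cmult[OF e(1)]]) (use b in simp)
      ultimately show "\<bar>J (conv e h)\<bar> \<le> J ?S" unfolding sc[OF e(1)] by linarith
    qed
  qed
  show "\<exists>I. invariant_normalized_integral Cb_lu f I"
  proof (intro exI[of _ "\<lambda>h. J (conv \<phi> h)"])
    show "invariant_normalized_integral Cb_lu f (\<lambda>h. J (conv \<phi> h))"
      unfolding invariant_normalized_integral_def
    proof (intro conjI ballI allI impI)
      fix h h' assume h: "h \<in> dominated Cb_lu f" and h': "h' \<in> dominated Cb_lu f"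
      show "J (conv \<phi> h) = J (conv \<phi> h')" if "\<forall>\<^sub>F x in snd Cb_lu. h x = h' x"
      proof -
        have "h = h'" using that by (auto simp: Cb_lu_def)
        then show ?thesis by simp
      qed
      have "conv \<phi> (\<lambda>x. h x + h' x) = (\<lambda>x. conv \<phi> h x + conv \<phi> h' x)"
        by (intro ext conv_add_right conv_integrable \<phi>(1) dom_b h h')
      then show "J (conv \<phi> (\<lambda>x. h x + h' x)) = J (conv \<phi> h) + J (conv \<phi> h')"
        using J_add[OF mem[OF h \<phi>(1)] mem[OF h' \<phi>(1)]] by simp
    next
      fix c h assume h: "h \<in> dominated Cb_lu f"
      have "conv \<phi> (\<lambda>x. c * h x) = (\<lambda>x. c * conv \<phi> h x)" by (intro ext conv_cmult)
      then show "J (conv \<phi> (\<lambda>x. c * h x)) = c * J (conv \<phi> h)"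
        using J_scale[OF mem[OF h \<phi>(1)]] by simp
    next
      fix h assume h: "h \<in> dominated Cb_lu f" and "\<forall>\<^sub>F x in snd Cb_lu. 0 \<le> h x"
      then have "0 \<le> h x" for x by (simp add: Cb_lu_def)
      then show "0 \<le> J (conv \<phi> h)" by (intro J_pos mem h \<phi>(1) nonneg)
    next
      fix g h assume h: "h \<in> dominated Cb_lu f"
      \<comment> \<open>Translating \<open>h\<close> amounts to replacing \<phi> by \<open>d\<close>
        times \<open>?\<phi>\<close>, which has the same integral. By uniqueness the functional
        takes the same value on both; the positive integral of \<phi> is cancelled at the
        end.\<close>
      interpret R: invariant_functional m "\<lambda>e. J (conv e h)" by (rule radon[OF h])
      let ?\<phi> = "right_translate (- g) \<phi>"
      have t: "?\<phi> \<in> Cc" unfolding right_translate_def by (rule Cc_translate(2)[OF \<phi>(1)])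
      obtain d where d: "\<And>x. conv \<phi> (left_translate g h) x = d * conv ?\<phi> h x"
        "(\<integral>s. \<phi> s \<partial>m) = d * (\<integral>s. ?\<phi> s \<partial>m)"
        using conv_modular[of g] \<phi>(1) dom_b[OF h] by metis
      have "conv \<phi> (left_translate g h) = (\<lambda>x. d * conv ?\<phi> h x)" by (intro ext d(1))
      then have "J (conv \<phi> (left_translate g h)) = d * J (conv ?\<phi> h)"
        using J_scale[OF mem[OF h t]] by simp
      then have "J (conv \<phi> (left_translate g h)) * (\<integral>s. \<phi> s \<partial>m)
          = d * (J (conv ?\<phi> h) * (\<integral>s. \<phi> s \<partial>m))" by simp
      also have "\<dots> = J (conv \<phi> h) * (d * (\<integral>s. ?\<phi> s \<partial>m))"
        unfolding R.unique[OF t \<phi>(1)] by simp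
      finally show "J (conv \<phi> (left_translate g h)) = J (conv \<phi> h)"
        unfolding d(2)[symmetric] using I\<phi> by simp
    next
      show "J ?f = 1" by (rule J_f)
    qed
  qed
qed

text \<open>Non-empty open sets are not null, so a continuous function vanishing almost everywhere
  vanishes identically. Hence a non-zero element of \<open>Cb\<close> is non-zero in
  \<open>L_infty m\<close>, and integrals restrict.\<close>

lemma property_Cb:
  assumes "invariant_normalized_integral_property (L_infty m)"
  shows "invariant_normalized_integral_property (Cb :: 'a function_space)"
proof (rule property_mono[OF _ _ _ assms])
  show "fst Cb \<subseteq> fst (L_infty m)"
    using bcontfun_borel bcontfun_bounded by (auto simp: Cb_def L_infty_def)
  show "snd (L_infty m) \<le> snd Cb" by (simp add: Cb_def)
  fix f :: "'a \<Rightarrow> real" assume "f \<in> fst Cb" and "\<forall>\<^sub>F x in snd (L_infty m). f x = 0"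
  then have f: "f \<in> bcontfun" and ae: "AE x in m. f x = 0" by (auto simp: Cb_def L_infty_def)
  let ?U = "{x. f x \<noteq> 0}"
  have U: "open ?U" using bcontfun_continuous[OF f] by (intro open_Collect_neq continuous_on_const)
  have "AE x in m. x \<notin> ?U" using ae by simp
  then have "emeasure m ?U = 0"
    using U by (subst (asm) AE_iff_null) (auto simp: sets_m space_m null_sets_def)
  then have "?U = {}" using emeasure_open[OF U] by blast
  then show "\<forall>\<^sub>F x in snd Cb. f x = 0" by (simp add: Cb_def)
qed

end

theorem theorem4:
  fixes m :: "'a::{topological_group_add,t2_space} measure"
    and E F :: "'a function_space"
  assumes "locally_compact_space (euclidean :: 'a topology)"
    and "left_haar_measure m"
    and "E \<in> {L_infty m, Cb, Cb_lu, Cb_ru, Cb_u}"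
    and "F \<in> {L_infty m, Cb, Cb_lu, Cb_ru, Cb_u}"
    and "invariant_normalized_integral_property E"
  shows "invariant_normalized_integral_property F"
proof -
  interpret haar_group m using assms(1,2) by unfold_locales
  let ?P = "invariant_normalized_integral_property :: 'a function_space \<Rightarrow> bool"
  have 1: "?P (L_infty m) \<Longrightarrow> ?P Cb" by (rule property_Cb)
  have 2: "?P Cb \<Longrightarrow> ?P Cb_ru" by (erule property_mono[rotated 3]) (auto simp: Cb_def Cb_ru_def)
  have 3: "?P Cb_ru \<Longrightarrow> ?P Cb_u" by (erule property_mono[rotated 3]) (auto simp: Cb_u_def Cb_ru_def)
  have 4: "?P Cb_u \<Longrightarrow> ?P Cb_lu" by (rule property_Cb_lu)
  have 5: "?P Cb_lu \<Longrightarrow> ?P (L_infty m)" by (rule property_L_infty)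
  show ?thesis using assms(3-5) 1 2 3 4 5 by auto
qed

end
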